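(* Let $n\ge 0$ be an integer. Each of the following three quantities equals $\frac{9n^2-5n+2}{2}$: (i) the maximum number of regions into which the plane can be divided by drawing $n$ long-legged 3-armed V's; (ii) the maximum number of regions into which the plane can be divided by drawing $n$ 3-chains; (iii) the maximum number of regions into which the plane can be divided by drawing $n$ long-legged A's.
   Context: For a family $\mathcal F$ of subsets of $\mathbb R^2$ ("shapes"), the number of regions determined by $S_1,\dots,S_n\in\mathcal F$ is the number of connected components of $\mathbb R^2\setminus (S_1\cup\dots\cup S_n)$, and the maximum number of regions for $n$ copies is the maximum of this over all choices of $S_1,\dots,S_n\in\mathcal F$ (for $n=0$ it is $1$). A long-legged 3-armed V is the union of three rays (closed half-lines) emanating from a common point (the tip), with arbitrary angles between them. A 3-chain is a continuous polygonal curve consisting of a ray, then a finite line segment, then a ray (the two rays being attached to the two endpoints of the segment). A long-legged A is the union of two rays emanating from a common point (the tip), with arbitrary angle between them, together with a line segment (crossbar) joining a point of one ray to a point of the other ray (the two endpoints need not be at equal distance from the tip). *)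

theory Defs
  imports "HOL-Analysis.Analysis"
begin

definition ray :: "real^2 \<Rightarrow> real^2 \<Rightarrow> (real^2) set" where
  "ray p v = {p + t *\<^sub>R v | t. 0 \<le> t}"

definition three_armed_Vs :: "(real^2) set set" where
  "three_armed_Vs =
     {ray p u \<union> ray p v \<union> ray p w | p u v w. u \<noteq> 0 \<and> v \<noteq> 0 \<and> w \<noteq> 0}"

text \<open>The two rays of a chain may cross each other: a 3-chain need not be a simple curve.\<close>

definition three_chains :: "(real^2) set set" where
  "three_chains =
     {ray p u \<union> closed_segment p q \<union> ray q v | p q u v. u \<noteq> 0 \<and> v \<noteq> 0 \<and> p \<noteq> q}"

definition long_legged_As :: "(real^2) set set" where
  "long_legged_As =
     {ray p u \<union> ray p v \<union> closed_segment a b | p u v a b.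
        u \<noteq> 0 \<and> v \<noteq> 0 \<and> a \<in> ray p u \<and> b \<in> ray p v \<and> a \<noteq> b}"

definition regions :: "nat \<Rightarrow> (nat \<Rightarrow> (real^2) set) \<Rightarrow> (real^2) set set" where
  "regions n S = components (UNIV - (\<Union>i<n. S i))"

text \<open>
  The value \<open>m\<close> is the maximum, over all choices of \<open>n\<close> shapes from the family \<open>F\<close>, of the number
  of regions.  Finiteness is stated explicitly because \<^const>\<open>card\<close> is 0 on infinite sets.
\<close>

definition is_max_regions :: "(real^2) set set \<Rightarrow> nat \<Rightarrow> real \<Rightarrow> bool" where
  "is_max_regions F n m \<longleftrightarrow>
     (\<exists>S. (\<forall>i<n. S i \<in> F) \<and> finite (regions n S) \<and> real (card (regions n S)) = m) \<and>
     (\<forall>S. (\<forall>i<n. S i \<in> F) \<longrightarrow> finite (regions n S) \<and> real (card (regions n S)) \<le> m)"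

end

theory Submission
  imports Defs
begin

text \<open>
  Adding to a closed set \<open>A\<close> a straight gap (a segment or half-line whose interior avoids \<open>A\<close>)
  creates at most one new region, since only the two sides of the gap can become separated, and
  creates none if the gap has a free end, around which the two sides are joined.

  Upper bound: let \<open>m\<close> shapes be drawn already, consisting of \<open>3 m\<close> convex pieces.  A new piece meets
  each old one in a convex set, so it consists of boundedly many gaps; adding the pieces of a shape in
  an order that keeps them attached to each other gives at most \<open>9 m + 2\<close> new regions.

  Lower bound: take \<open>3 n\<close> full lines such that all crossings lie on the parts belonging to the shapes.
  The number of regions of a line arrangement is bounded below by counting which sets of lines can lie
  below a point.  Erasing the superfluous ends of the lines is the reverse of adding one gap per end,
  hence loses at most one region per end, and this leaves exactly the claimed number.
\<close>

section \<open>Removing a straight gap from an open set\<close>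

text \<open>Both bounds avoid Euler's formula: pieces may overlap, coincide or pass through one
  point, which would spoil a count of vertices and edges, whereas a convex set meets a line in an
  interval in every degenerate position. The two inequalities meet because of a balance inside each
  shape. Upwards, a shape is charged \<open>3 * k + 2\<close> against \<open>k\<close> old convex
  pieces. Downwards, let a cluster of three lines have \<open>v\<close> distinct crossings, summed
  over its lines and counted on each line with the earlier ones only, and let \<open>e\<close> ends
  be missing; beyond its crossings with earlier clusters it yields \<open>v + 3 - e\<close> regions.
  This is 2 exactly if \<open>e = v + 1\<close>: three concurrent lines give \<open>v = 2\<close>,
  \<open>e = 3\<close>, a triangle gives \<open>v = 3\<close>, \<open>e = 4\<close>. The third
  corner of the triangle is why the chain is drawn crossing itself. The obstacle is that ends can be
  erased only beyond all crossings, and that the crossings on a line must stay distinct; slightly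
  perturbed tangents to a parabola put the crossings of a line with different clusters into separate
  windows and leave room outside for the corners of each cluster.\<close>

text \<open>A half ball on the positive side of a point of \<open>g\<close> is convex and misses
  \<open>g\<close>, so it lies in one component. Half balls at nearby points overlap, so this
  component is locally constant along the connected set \<open>g\<close>, hence constant.\<close>

lemma side_in_one_component:
  fixes U g :: "'a::euclidean_space set"
  assumes "open U" "g \<subseteq> U" "connected g" and n: "n \<noteq> 0" and g: "g \<subseteq> {x. n \<bullet> x = c}"
  shows "\<exists>P. \<forall>x r y. x \<in> g \<longrightarrow> ball x r \<subseteq> U \<longrightarrow> y \<in> ball x r \<longrightarrow> n \<bullet> y > c \<longrightarrow>
                connected_component_set (U - g) y = P"
proof -
  define H where "H x r = ball x r \<inter> {y. n \<bullet> y > c}" for x r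
  have same: "connected_component_set (U - g) y = connected_component_set (U - g) z"
    if "ball x r \<subseteq> U" "y \<in> H x r" "z \<in> H x r" for x r y z
  proof -
    have "convex (H x r)"
      unfolding H_def by (intro convex_Int convex_ball convex_halfspace_gt)
    moreover have "H x r \<subseteq> U - g"
      using that(1) g by (auto simp: H_def)
    ultimately have "connected_component (U - g) y z"
      using that convex_connected unfolding connected_component_def by blast
    then show ?thesis
      using connected_component_eq_eq by (metis connected_component_in)
  qed
  have "\<forall>x\<in>g. \<exists>r>0. ball x r \<subseteq> U"
    using \<open>open U\<close> \<open>g \<subseteq> U\<close> by (meson openE subsetD)
  then obtain r where r: "\<And>x. x \<in> g \<Longrightarrow> r x > 0 \<and> ball x (r x) \<subseteq> U"
    by metis
  \<comment> \<open>A point at distance \<open>t / 2\<close> from \<open>x\<close> on the positive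
    side.\<close>
  define h where "h x t = x + (t / (2 * norm n)) *\<^sub>R n" for x t
  have h: "h x t \<in> H x t" if "x \<in> g" "t > 0" for x t
  proof -
    have "n \<bullet> h x t = c + (t / (2 * norm n)) * (n \<bullet> n)"
      using that g by (auto simp: h_def inner_add_right)
    moreover have "(t / (2 * norm n)) * (n \<bullet> n) > 0"
      using that n by (intro mult_pos_pos) auto
    moreover have "dist x (h x t) < t"
      using that n by (simp add: h_def dist_norm)
    ultimately show ?thesis by (simp add: H_def)
  qed
  define cp where "cp x = connected_component_set (U - g) (h x (r x))" for x
  have *: "connected_component_set (U - g) y = cp x"
    if "x \<in> g" "ball x s \<subseteq> U" "y \<in> H x s" for x s y
  proof -
    \<comment> \<open>With the smaller radius, \<open>h x m\<close> lies in both half balls, so the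
      component does not depend on the radius.\<close>
    define m where "m = min s (r x)"
    have "s > 0" using that(3) unfolding H_def by (metis IntD1 ball_empty empty_iff not_le)
    then have "m > 0" using r that by (simp add: m_def)
    then have m: "h x m \<in> H x s" "h x m \<in> H x (r x)"
      using h[of x m] that by (auto simp: H_def m_def)
    have "connected_component_set (U - g) y = connected_component_set (U - g) (h x m)"
      using same[OF that(2,3) m(1)] .
    also have "\<dots> = cp x"
      unfolding cp_def using same[OF _ m(2)] h r that by blast
    finally show ?thesis .
  qed
  have const: "cp x = cp y" if "x \<in> g" "y \<in> g" for x y
  proof (rule connected_local_const[OF \<open>connected g\<close> that], intro ballI)
    fix a assume a: "a \<in> g"
    show "eventually (\<lambda>b. cp a = cp b) (at a within g)"
      unfolding eventually_at
    proof (intro exI conjI ballI impI)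
      show "r a > 0" using r a by auto
      fix b assume b: "b \<in> g" "b \<noteq> a \<and> dist b a < r a"
      then obtain s where s: "s > 0" "ball b s \<subseteq> ball a (r a)"
        by (metis dist_commute mem_ball open_ball openE)
      then have "h b s \<in> H b s" "h b s \<in> H a (r a)"
        using h[OF b(1) s(1)] by (auto simp: H_def)
      then show "cp a = cp b"
        using *[OF a, of "r a" "h b s"] *[OF b(1), of s "h b s"] r[OF a] s by auto
    qed
  qed
  have "connected_component_set (U - g) y = cp (SOME z. z \<in> g)"
    if "x \<in> g" "ball x s \<subseteq> U" "y \<in> ball x s" "n \<bullet> y > c" for x s y
    using *[OF that(1,2), of y] that const[OF that(1) someI[of "\<lambda>z. z \<in> g", OF that(1)]]
    by (simp add: H_def)
  then show ?thesis by (intro exI allI impI)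
qed

text \<open>A component of \<open>U - g\<close> that does not adhere to \<open>g\<close> is already
  a component of \<open>U\<close>, other than the one that \<open>g\<close> cuts; one that adheres
  to \<open>g\<close> reaches a side of it, hence is \<open>P\<close> or \<open>Q\<close>. So one
  old component is traded for at most two. If the hyperplane continues beyond \<open>g\<close>
  arbitrarily close to \<open>e\<close>, a path around \<open>e\<close> joins the sides and
  \<open>P = Q\<close>.\<close>

lemma components_minus_gap:
  fixes U g :: "'a::euclidean_space set"
  assumes U: "open U" "g \<subseteq> U" "open (U - g)" and "connected g" "g \<noteq> {}"
    and n: "n \<noteq> 0" and g: "g \<subseteq> {x. n \<bullet> x = c}"
    and fin: "finite (components U)"
  shows "finite (components (U - g)) \<and> card (components (U - g)) \<le> card (components U) + 1"
    and "e \<in> g \<Longrightarrow> e \<in> closure ({x. n \<bullet> x = c} - g) \<Longrightarrow>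
           card (components (U - g)) \<le> card (components U)"
proof -
  obtain P where P: "\<forall>x r y. x \<in> g \<longrightarrow> ball x r \<subseteq> U \<longrightarrow> y \<in> ball x r \<longrightarrow> n \<bullet> y > c \<longrightarrow>
      connected_component_set (U - g) y = P"
    using side_in_one_component[OF U(1,2) \<open>connected g\<close> n g] by (elim exE)
  note P = P[rule_format]
  have n': "- n \<noteq> 0" and g': "g \<subseteq> {x. - n \<bullet> x = - c}" using n g by auto
  obtain Q where Q: "\<forall>x r y. x \<in> g \<longrightarrow> ball x r \<subseteq> U \<longrightarrow> y \<in> ball x r \<longrightarrow> - n \<bullet> y > - c \<longrightarrow>
      connected_component_set (U - g) y = Q"
    using side_in_one_component[OF U(1,2) \<open>connected g\<close> n' g'] by (elim exE)
  have Q: "connected_component_set (U - g) y = Q"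
    if "x \<in> g" "ball x r \<subseteq> U" "y \<in> ball x r" "n \<bullet> y < c" for x r y
    using Q[rule_format, OF that(1-3)] that(4) by simp
  obtain x0 where x0: "x0 \<in> g" using \<open>g \<noteq> {}\<close> by blast
  define U0 where "U0 = connected_component_set U x0"
  have U0: "U0 \<in> components U" "x0 \<in> U0"
    using x0 U(2) by (auto simp: U0_def components_def)
  have cases: "C \<in> components U - {U0} \<or> C = P \<or> C = Q" if C: "C \<in> components (U - g)" for C
  proof (rule ccontr)
    assume neg: "\<not> ?thesis"
    have CU: "C \<subseteq> U - g" using C in_components_subset by blast
    have eq: "connected_component_set (U - g) y = C" if "y \<in> C" for y
      using C that by (metis components_iff connected_component_eq)
    have op: "open C" using C U(3) open_components by blast
    \<comment> \<open>Near \<open>x\<close> all points off the hyperplane belong to \<open>P\<close>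
      or \<open>Q\<close>, so the open set \<open>C\<close> would have to lie inside the hyperplane
      there.\<close>
    have "x \<notin> closure C" if x: "x \<in> g" for x
    proof
      assume "x \<in> closure C"
      obtain r where r: "r > 0" "ball x r \<subseteq> U" using x U by (meson openE subsetD)
      obtain y where y: "y \<in> C" "y \<in> ball x r"
        using \<open>x \<in> closure C\<close> r(1) unfolding closure_approachable by (auto simp: dist_commute)
      have sub: "C \<inter> ball x r \<subseteq> {y. n \<bullet> y = c}"
        proof clarsimp
        fix y assume "y \<in> C" "dist x y < r"
        then show "n \<bullet> y = c"
          using P[OF x r(2), of y] Q[OF x r(2), of y] eq[of y] neg by (metis linorder_cases mem_ball)
      qed
      have "C \<inter> ball x r \<subseteq> interior {y. n \<bullet> y = c}"
        using sub op by (intro interior_maximal) auto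
      then show False using y n by auto
    qed
    then have clo: "closure C \<inter> U \<subseteq> C"
    proof -
      have "closedin (top_of_set (U - g)) C" using C closedin_component by blast
      then have "closure C \<inter> (U - g) \<subseteq> C"
        using closure_minimal[of C] unfolding closedin_closed by blast
      then show ?thesis using \<open>\<And>x. x \<in> g \<Longrightarrow> x \<notin> closure C\<close> by blast
    qed
    have "C \<in> components U"
    proof -
      obtain y where y: "y \<in> C" using C in_components_nonempty by blast
      have con: "connected C" using C in_components_connected by blast
      let ?D = "connected_component_set U y"
      have yU: "y \<in> U" using y CU by blast
      have "C \<subseteq> ?D" using con y CU by (intro connected_component_maximal) auto
      \<comment> \<open>\<open>C\<close> is open and, by \<open>clo\<close>, closed relative to
        \<open>U\<close>, so the connected set \<open>?D\<close> cannot leave it.\<close>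
      moreover have "?D \<subseteq> C"
      proof (rule ccontr)
        assume "\<not> ?D \<subseteq> C"
        moreover have "?D \<subseteq> U" by (rule connected_component_subset)
        moreover have "connected ?D" by simp
        moreover have "y \<in> ?D" using yU by simp
        ultimately show False
          using connectedD[of ?D C "- closure C"] op y clo closure_subset[of C] by blast
      qed
      ultimately show ?thesis using yU by (metis componentsI subset_antisym)
    qed
    then have "C = U0" using neg by blast
    then show False using U0 CU x0 by blast
  qed
  have sub: "components (U - g) \<subseteq> (components U - {U0}) \<union> {P, Q}"
    using cases by blast
  show "finite (components (U - g)) \<and> card (components (U - g)) \<le> card (components U) + 1"
  proof (rule conjI[rotated])
    have "card (components (U - g)) \<le> card ((components U - {U0}) \<union> {P, Q})"
      using sub fin by (intro card_mono) auto
    also have "\<dots> \<le> card (components U - {U0}) + card {P, Q}" by (rule card_Un_le)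
    also have "\<dots> \<le> (card (components U) - 1) + 2"
      using U0 by (intro add_mono) (auto simp: card_insert_if)
    also have "\<dots> \<le> card (components U) + 1"
    proof -
      have "card (components U) > 0" using U0 fin by (auto simp: card_gt_0_iff)
      then show ?thesis by simp
    qed
    finally show "card (components (U - g)) \<le> card (components U) + 1" .
  next
    show "finite (components (U - g))" using fin by (intro finite_subset[OF sub]) auto
  qed
  assume e: "e \<in> g" "e \<in> closure ({x. n \<bullet> x = c} - g)"
  obtain r where r: "r > 0" "ball e r \<subseteq> U" using e U by (meson openE subsetD)
  \<comment> \<open>The passage from side to side: \<open>z\<close> lies on the hyperplane beyond
    the end of \<open>g\<close>, and a small ball around it avoids \<open>g\<close> while meeting
    both sides near \<open>e\<close>.\<close>
  obtain z where z: "z \<in> ball e r" "n \<bullet> z = c" "z \<notin> g"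
    using e(2) r(1) unfolding closure_approachable by (auto simp: dist_commute)
  have zU: "z \<in> U - g" using z r by blast
  obtain s where s: "s > 0" "ball z s \<subseteq> ball e r \<inter> (U - g)"
    using z zU U(3) by (metis IntI openE open_Int open_ball)
  define w where "w t = z + (t * s / (2 * norm n)) *\<^sub>R n" for t :: real
  have w: "w t \<in> ball z s" if "\<bar>t\<bar> \<le> 1" for t
  proof -
    have "\<bar>t\<bar> * s \<le> 1 * s" using that s by (intro mult_right_mono) auto
    then show ?thesis using s n by (simp add: w_def dist_norm abs_mult)
  qed
  have nw: "n \<bullet> w t = c + t * (s / (2 * norm n) * (n \<bullet> n))" for t
    using z by (simp add: w_def inner_add_right)
  have pos: "s / (2 * norm n) * (n \<bullet> n) > 0"
    using s n by (intro mult_pos_pos) auto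
  have "P = connected_component_set (U - g) (w 1)"
    using P[OF e(1) r(2), of "w 1"] w[of 1] s nw[of 1] pos by auto
  moreover have "Q = connected_component_set (U - g) (w (-1))"
    using Q[OF e(1) r(2), of "w (-1)"] w[of "-1"] s nw[of "-1"] pos by auto
  moreover have "connected_component (U - g) (w 1) (w (-1))"
    unfolding connected_component_def
    using s w[of 1] w[of "-1"] by (intro exI[of _ "ball z s"]) auto
  ultimately have "P = Q"
    by (metis connected_component_eq_eq connected_component_in)
  then have "components (U - g) \<subseteq> insert P (components U - {U0})"
    using sub by blast
  then have "card (components (U - g)) \<le> card (insert P (components U - {U0}))"
    using fin by (intro card_mono) auto
  also have "\<dots> \<le> Suc (card (components U - {U0}))"
    using fin by (simp add: card_insert_if)
  also have "\<dots> = card (components U)"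
    using U0 fin by (metis card_Suc_Diff1)
  finally show "card (components (U - g)) \<le> card (components U)" .
qed

section \<open>Adding segments and rays\<close>

text \<open>Finiteness is a premise for \<open>A\<close> and a conclusion for \<open>B\<close>, so
  that the bounds chain and \<open>card\<close> never speaks about an infinite set.\<close>

definition cuts :: "nat \<Rightarrow> (real^2) set \<Rightarrow> (real^2) set \<Rightarrow> bool" where
  "cuts k A B \<longleftrightarrow> (finite (components (- A)) \<longrightarrow>
     finite (components (- B)) \<and> card (components (- B)) \<le> card (components (- A)) + k)"

lemma cuts_refl [simp]: "cuts k A A"
  by (simp add: cuts_def)

lemma cuts_trans: "cuts k A B \<Longrightarrow> cuts l B C \<Longrightarrow> cuts (k + l) A C"
  by (auto simp: cuts_def)

lemma cuts_mono: "cuts k A B \<Longrightarrow> k \<le> l \<Longrightarrow> cuts l A B"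
  by (auto simp: cuts_def)

abbreviation along :: "real^2 \<Rightarrow> real^2 \<Rightarrow> real \<Rightarrow> real^2" where
  "along p v t \<equiv> p + t *\<^sub>R v"

lemma continuous_along: "continuous_on S (along p v)"
  by (intro continuous_intros)

lemma along_image_closed:
  assumes "closed J" "v \<noteq> 0"
  shows "closed (along p v ` J)"
proof -
  have "linear (\<lambda>t. t *\<^sub>R v)" by (simp add: linear_scaleR_left)
  moreover have "inj (\<lambda>t::real. t *\<^sub>R v)" using assms by (auto intro: injI)
  ultimately have "closed ((+) p ` ((\<lambda>t. t *\<^sub>R v) ` J))"
    using assms by (intro closed_translation closed_injective_linear_image)
  then show ?thesis by (simp add: image_image)
qed

text \<open>The normal \<open>n\<close> is \<open>v\<close> turned by a right angle. In the second
  part the end with parameter \<open>a\<close> belongs to the gap, hence is not on \<open>A\<close>: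
  this is the free end, approached along the line by parameters below \<open>a\<close>.\<close>

lemma cuts_gap:
  assumes A: "closed A" and v: "v \<noteq> 0" and J: "connected J"
    and disj: "along p v ` J \<inter> A = {}" and cl: "closed (A \<union> along p v ` J)"
  shows "cuts 1 A (A \<union> along p v ` J)"
    and "a \<in> J \<Longrightarrow> J \<subseteq> {a..} \<Longrightarrow> cuts 0 A (A \<union> along p v ` J)"
proof -
  let ?g = "along p v ` J"
  define n :: "real^2" where "n = vector [- (v$2), v$1]"
  have n: "n \<noteq> 0"
  proof
    assume "n = 0"
    then have "n $ 1 = 0" "n $ 2 = 0" by auto
    then have "v = 0" by (simp add: n_def vec_eq_iff forall_2)
    then show False using v by simp
  qed
  have nv: "n \<bullet> along p v t = n \<bullet> p" for t
    by (simp add: n_def inner_vec_def sum_2 algebra_simps)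
  have g: "?g \<subseteq> {x. n \<bullet> x = n \<bullet> p}" using nv by auto
  have con: "connected ?g" using J by (intro connected_continuous_image continuous_along)
  have eq: "- (A \<union> ?g) = - A - ?g" by blast
  have op: "open (- A)" "?g \<subseteq> - A" "open (- A - ?g)"
    using A disj open_Compl[OF cl] unfolding eq by blast+
  note * = components_minus_gap[OF op con _ n g]
  show "cuts 1 A (A \<union> ?g)"
    using *(1) unfolding cuts_def eq by (cases "J = {}") simp_all
  assume a: "a \<in> J" "J \<subseteq> {a..}"
  have "along p v a \<in> closure ({x. n \<bullet> x = n \<bullet> p} - ?g)"
    unfolding closure_approachable
  proof (intro allI impI)
    fix e :: real assume "e > 0"
    define t where "t = a - e / (2 * norm v)"
    have "t < a" using \<open>e > 0\<close> v by (simp add: t_def)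
    then have "along p v t \<notin> ?g" using a v by auto
    moreover have "dist (along p v t) (along p v a) < e"
    proof -
      have "along p v t - along p v a = (- (e / (2 * norm v))) *\<^sub>R v"
        by (simp add: t_def algebra_simps)
      then show ?thesis using v \<open>e > 0\<close> by (simp add: dist_norm)
    qed
    ultimately show "\<exists>y\<in>{x. n \<bullet> x = n \<bullet> p} - ?g. dist y (along p v a) < e"
      using nv by blast
  qed
  then show "cuts 0 A (A \<union> ?g)"
    using *(1) *(2)[of "along p v a"] a unfolding cuts_def eq by auto
qed

text \<open>At most \<open>k + 1\<close> intervals, one of them reaching \<open>b\<close>, leave at
  most \<open>k\<close> gaps between them; a further gap at parameter 0 has a free end and costs
  nothing. The induction draws the last gap and drops the last interval.\<close>

lemma cuts_segment_param:
  assumes v: "v \<noteq> 0"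
  shows "closed A \<Longrightarrow> finite T \<Longrightarrow> card T \<le> Suc k \<Longrightarrow> (\<And>I. I \<in> T \<Longrightarrow> closed I \<and> convex I) \<Longrightarrow>
    {t\<in>{0..b}. along p v t \<in> A} = \<Union>T \<Longrightarrow> b \<in> \<Union>T \<Longrightarrow> cuts k A (A \<union> along p v ` {0..b})"
proof (induction k arbitrary: A T b rule: less_induct)
  case (less k)
  let ?f = "along p v"
  note A = \<open>closed A\<close> and T = \<open>\<And>I. I \<in> T \<Longrightarrow> closed I \<and> convex I\<close>
    and eq = \<open>{t\<in>{0..b}. ?f t \<in> A} = \<Union>T\<close>
  obtain I where I: "I \<in> T" "b \<in> I" using less.prems by blast
  have inT: "t \<in> \<Union>T \<longleftrightarrow> 0 \<le> t \<and> t \<le> b \<and> ?f t \<in> A" for t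
    using eq by auto
  have bd: "I' \<subseteq> {0..b}" if "I' \<in> T" for I' using eq that by auto
  have cpt: "compact I'" if "I' \<in> T" for I'
    using T[OF that] bd[OF that] by (meson bounded_subset bounded_closed_interval compact_eq_bounded_closed)
  define s where "s = Inf I"
  have sI: "s \<in> I" unfolding s_def
    using cpt[OF I(1)] I(2) T[OF I(1)] by (intro closed_contains_Inf) (auto intro: bounded_imp_bdd_below compact_imp_bounded)
  have s_min: "s \<le> t" if "t \<in> I" for t unfolding s_def
    using cpt[OF I(1)] that by (intro cInf_lower) (auto intro: bounded_imp_bdd_below compact_imp_bounded)
  have s0: "0 \<le> s" "s \<le> b" using bd[OF I(1)] sI by auto
  have "{s..b} \<subseteq> I"
    using T[OF I(1)] sI I(2) by (metis atLeastatMost_subset_iff closed_segment_eq_real_ivl closed_segment_subset s0(2))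
  then have sb: "?f t \<in> A" if "s \<le> t" "t \<le> b" for t
    using that I(1) inT by (metis UnionI atLeastAtMost_iff subsetD)
  \<comment> \<open>What the other intervals cover up to \<open>s\<close>. The intervals may
    overlap, so its supremum \<open>t'\<close> may equal \<open>s\<close>; then the gap between
    \<open>t'\<close> and \<open>s\<close> is empty and its charge of 1 is merely wasted.\<close>
  define D where "D = \<Union>(T - {I}) \<inter> {0..s}"
  show ?case
  proof (cases "D = {}")
    case True
    have free: "?f t \<notin> A" if "0 \<le> t" "t < s" for t
    proof
      assume "?f t \<in> A"
      then have "t \<in> \<Union>T" using inT that s0 by auto
      moreover have "t \<notin> I" using s_min[of t] that by auto
      ultimately have "t \<in> D" using that by (auto simp: D_def)
      then show False using True by simp
    qed
    have un: "A \<union> ?f ` {0..b} = A \<union> ?f ` {0..<s}"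
    proof -
      have "{0..b} = {0..<s} \<union> {s..b}" using s0 by auto
      moreover have "?f ` {s..b} \<subseteq> A" using sb by auto
      ultimately show ?thesis by (auto simp: image_Un)
    qed
    show ?thesis
    proof (cases "s = 0")
      case True
      then show ?thesis unfolding un by simp
    next
      case False
      have "closed (A \<union> ?f ` {0..<s})"
        unfolding un[symmetric] using A v by (intro closed_Un along_image_closed) auto
      then have "cuts 0 A (A \<union> ?f ` {0..<s})"
        using free A v False s0 by (intro cuts_gap(2)[of _ _ _ _ 0]) auto
      then show ?thesis unfolding un by (rule cuts_mono) simp
    qed
  next
    case False
    have "compact D"
      unfolding D_def using cpt less.prems(2) by (intro compact_Int compact_Union) auto
    define t' where "t' = Sup D"
    have t'D: "t' \<in> D" unfolding t'_def
      using \<open>compact D\<close> False by (intro closed_contains_Sup) (auto intro: bounded_imp_bdd_above compact_imp_bounded compact_imp_closed)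
    have t'_max: "t \<le> t'" if "t \<in> D" for t unfolding t'_def
      using \<open>compact D\<close> that by (intro cSup_upper) (auto intro: bounded_imp_bdd_above compact_imp_bounded)
    have t': "0 \<le> t'" "t' \<le> s" using t'D by (auto simp: D_def)
    have "t' \<in> \<Union>T" using t'D by (auto simp: D_def)
    then have ft': "?f t' \<in> A" using inT by blast
    have free: "?f t \<notin> A" if "t' < t" "t < s" for t
    proof
      assume "?f t \<in> A"
      then have "t \<in> \<Union>T" using inT that s0 t' by auto
      moreover have "t \<notin> I" using s_min[of t] that by auto
      ultimately have "t \<in> D" using that t' by (auto simp: D_def)
      then show False using t'_max that by force
    qed
    define A' where "A' = A \<union> ?f ` {t'<..<s}"
    have A'_eq: "A' = A \<union> ?f ` {t'..s}"
    proof -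
      have "{t'..s} = {t'<..<s} \<union> {t', s}" using t' by auto
      then show ?thesis using sb[of s] s0 ft' by (auto simp: A'_def image_Un)
    qed
    have "closed A'"
      unfolding A'_eq using A v by (intro closed_Un along_image_closed) auto
    then have c1: "cuts 1 A A'"
      using free A v unfolding A'_def by (intro cuts_gap(1)) auto
    \<comment> \<open>One interval is gone and the rest are clipped at \<open>t'\<close>, which is
      covered by \<open>D\<close> and so is a legitimate new end point.\<close>
    define T' where "T' = (\<lambda>I. I \<inter> {0..t'}) ` (T - {I})"
    have "T - {I} \<noteq> {}" using False by (auto simp: D_def)
    have cT: "card (T - {I}) \<le> k"
      using less.prems(2,3) I(1) by (simp add: card_Diff_singleton)
    have "card (T - {I}) > 0" using \<open>T - {I} \<noteq> {}\<close> less.prems(2) by (simp add: card_gt_0_iff)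
    then have k: "k > 0" using cT by simp
    have "card T' \<le> card (T - {I})" unfolding T'_def using less.prems(2) by (intro card_image_le) auto
    then have cT': "card T' \<le> Suc (k - 1)" using cT k by simp
    have "cuts (k - 1) A' (A' \<union> ?f ` {0..t'})"
    proof (rule less.IH[OF _ \<open>closed A'\<close> _ cT'])
      show "k - 1 < k" using k by simp
      show "finite T'" using less.prems(2) by (simp add: T'_def)
      show "closed J \<and> convex J" if "J \<in> T'" for J
        using that T by (auto simp: T'_def intro!: convex_Int closed_Int)
      show "t' \<in> \<Union>T'" using t'D by (auto simp: T'_def D_def)
      have "?f t \<in> A' \<longleftrightarrow> ?f t \<in> A" if "t \<le> t'" for t
        using that v by (auto simp: A'_def)
      moreover have "?f t \<in> A \<longleftrightarrow> t \<in> \<Union>(T - {I})" if "0 \<le> t" "t \<le> t'" for t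
      proof
        assume "?f t \<in> A"
        then have tT: "t \<in> \<Union>T" using inT that t' s0 by auto
        show "t \<in> \<Union>(T - {I})"
        proof (cases "t \<in> I")
          case True
          then have "t = t'" using s_min[of t] t' that by auto
          then show ?thesis using t'D by (auto simp: D_def)
        qed (use tT in auto)
      next
        assume "t \<in> \<Union>(T - {I})"
        then have "t \<in> \<Union>T" by blast
        then show "?f t \<in> A" using inT by blast
      qed
      ultimately show "{t \<in> {0..t'}. ?f t \<in> A'} = \<Union>T'"
        by (auto simp: T'_def)
    qed
    then have "cuts k A (A' \<union> ?f ` {0..t'})"
      using cuts_trans[OF c1] k by fastforce
    moreover have "A' \<union> ?f ` {0..t'} = A \<union> ?f ` {0..b}"
    proof -
      have "{0..b} = {0..t'} \<union> {t'..s} \<union> {s..b}" using t' s0 by auto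
      moreover have "?f ` {s..b} \<subseteq> A" using sb by auto
      ultimately show ?thesis unfolding A'_eq image_Un[symmetric] by auto
    qed
    ultimately show ?thesis by simp
  qed
qed

text \<open>An unbounded interval means that the tail of the ray is already drawn, and a segment
  remains. Otherwise the far tail is drawn first, for free because its starting point is free; the
  segment back to the base then ends on the tail, so \<open>{b}\<close> is one extra interval and
  the \<open>k + 1\<close> intervals cost \<open>k\<close>.\<close>

lemma cuts_ray_param:
  assumes v: "v \<noteq> 0" and A: "closed A" and T: "finite T" "card T \<le> k"
    "\<And>I. I \<in> T \<Longrightarrow> closed I \<and> convex I"
    and eq: "{t\<in>{0..}. along p v t \<in> A} = \<Union>T"
  shows "cuts k A (A \<union> along p v ` {0..})"
proof (cases "\<exists>I\<in>T. \<not> bdd_above I")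
  let ?f = "along p v"
  have inT: "t \<in> \<Union>T \<longleftrightarrow> 0 \<le> t \<and> ?f t \<in> A" for t using eq by auto
  {
    case True
    then obtain I where I: "I \<in> T" "\<not> bdd_above I" by (elim bexE)
    then obtain b where b: "b \<in> I" by (metis all_not_in_conv bdd_above_empty)
    have b0: "b \<ge> 0" using inT[of b] b I(1) by blast
    have tail: "?f t \<in> A" if t: "t \<ge> b" for t
    proof -
      obtain u where u: "u \<in> I" "u \<ge> t" using I(2) unfolding bdd_above_def by (meson linear)
      then have "t \<in> closed_segment b u" using t by (simp add: closed_segment_eq_real_ivl)
      then have "t \<in> I" using T(3)[OF I(1)] b u closed_segment_subset by blast
      then show ?thesis using I(1) inT[of t] by blast
    qed
    define T' where "T' = (\<lambda>I. I \<inter> {0..b}) ` T"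
    have "cuts k A (A \<union> ?f ` {0..b})"
    proof (rule cuts_segment_param[OF v A, of T'])
      show "finite T'" using T by (simp add: T'_def)
      have "card T' \<le> card T" unfolding T'_def using T by (intro card_image_le)
      then show "card T' \<le> Suc k" using T by simp
      show "closed J \<and> convex J" if "J \<in> T'" for J
        using that T by (auto simp: T'_def intro!: convex_Int closed_Int)
      show "b \<in> \<Union>T'" using b b0 I by (auto simp: T'_def)
      show "{t \<in> {0..b}. ?f t \<in> A} = \<Union>T'" using inT by (auto simp: T'_def)
    qed
    moreover have "A \<union> ?f ` {0..b} = A \<union> ?f ` {0..}"
    proof -
      have "{0..} = {0..b} \<union> {b..}" using b0 by auto
      moreover have "?f ` {b..} \<subseteq> A" using tail by auto
      ultimately show ?thesis by (auto simp: image_Un)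
    qed
    ultimately show ?thesis by simp
  }
  {
    case False
    then have "bdd_above (\<Union>T)" using bdd_above_UN[OF T(1), of "\<lambda>I. I"] by simp
    then obtain M where M: "\<And>t. t \<in> \<Union>T \<Longrightarrow> t \<le> M" by (auto simp: bdd_above_def)
    define b where "b = max 0 M + 1"
    have b: "b > 0" "b > M" by (auto simp: b_def)
    \<comment> \<open>Beyond \<open>M\<close> the ray misses \<open>A\<close>, so the whole tail is
      a single gap.\<close>
    define A' where "A' = A \<union> ?f ` {b..}"
    have free: "?f t \<notin> A" if "t \<ge> b" for t
      using M[of t] inT[of t] that b by auto
    have cl: "closed A'" unfolding A'_def using A v by (intro closed_Un along_image_closed) auto
    have c0: "cuts 0 A A'"
      unfolding A'_def using A v free cl[unfolded A'_def] by (intro cuts_gap(2)[of _ _ _ _ b]) auto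
    have "cuts k A' (A' \<union> ?f ` {0..b})"
    proof (rule cuts_segment_param[OF v cl, of "insert {b} T"])
      show "card (insert {b} T) \<le> Suc k" using T by (simp add: card_insert_if)
      show "closed J \<and> convex J" if "J \<in> insert {b} T" for J using that T by auto
      have "?f t \<in> A' \<longleftrightarrow> t = b \<or> ?f t \<in> A" if "t \<le> b" for t
        using that v by (auto simp: A'_def)
      then have "{t \<in> {0..b}. ?f t \<in> A'} = {t \<in> {0..b}. t = b \<or> ?f t \<in> A}" by auto
      also have "\<dots> = insert b (\<Union>T)"
      proof (rule set_eqI)
        fix t show "t \<in> {t \<in> {0..b}. t = b \<or> ?f t \<in> A} \<longleftrightarrow> t \<in> insert b (\<Union>T)"
          using inT[of t] M[of t] b by auto
      qed
      finally show "{t \<in> {0..b}. ?f t \<in> A'} = \<Union>(insert {b} T)" by simp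
    qed (use T in auto)
    moreover have "A' \<union> ?f ` {0..b} = A \<union> ?f ` {0..}"
    proof -
      have "{0..} = {b..} \<union> {0..b}" using b by auto
      then show ?thesis by (simp add: A'_def image_Un Un_assoc)
    qed
    ultimately show ?thesis using cuts_trans[OF c0] by fastforce
  }
qed

section \<open>Rays and segments drawn across finite unions of convex sets\<close>

lemma along_vimage:
  assumes "closed C" "convex C"
  shows "closed (along p v -` C)" "convex (along p v -` C)"
proof -
  show "closed (along p v -` C)"
    using assms(1) by (intro continuous_closed_vimage) (auto intro!: continuous_intros)
  have "along p v -` C = (\<lambda>t. t *\<^sub>R v) -` ((+) (-p) ` C)"
    by (auto simp: image_iff) (metis add_minus_cancel uminus_add_conv_diff)
  moreover have "convex ((\<lambda>t. t *\<^sub>R v) -` ((+) (-p) ` C))"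
    using assms(2) by (intro convex_linear_vimage convex_translation) (simp add: linear_scaleR_left)
  ultimately show "convex (along p v -` C)" by simp
qed

lemma ray_eq_along: "ray p v = along p v ` {0..}"
  by (auto simp: ray_def)

lemma closed_segment_eq_along: "closed_segment p q = along p (q - p) ` {0..1}"
proof -
  have "(1 - t) *\<^sub>R p + t *\<^sub>R q = along p (q - p) t" for t
    by (simp add: algebra_simps)
  then show ?thesis by (auto simp: closed_segment_def)
qed

text \<open>Each piece meets a line in one closed interval, so \<open>k\<close> bounds the intervals
  met by a new piece. Only an upper bound is asked for, since pieces may coincide.\<close>

definition convex_union :: "nat \<Rightarrow> (real^2) set \<Rightarrow> bool" where
  "convex_union k A \<longleftrightarrow>
     (\<exists>\<C>. finite \<C> \<and> card \<C> \<le> k \<and> (\<forall>C\<in>\<C>. closed C \<and> convex C) \<and> A = \<Union>\<C>)"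

lemma convex_union_closed: "convex_union k A \<Longrightarrow> closed A"
  by (auto simp: convex_union_def intro!: closed_Union)

lemma convex_union_empty: "convex_union k {}"
  unfolding convex_union_def by (intro exI[of _ "{}"]) auto

lemma convex_union_Un:
  assumes "convex_union k A" "closed C" "convex C"
  shows "convex_union (Suc k) (A \<union> C)"
proof -
  obtain \<C> where "finite \<C>" "card \<C> \<le> k" "\<forall>C\<in>\<C>. closed C \<and> convex C" "A = \<Union>\<C>"
    using assms(1) unfolding convex_union_def by blast
  then show ?thesis
    unfolding convex_union_def using assms by (intro exI[of _ "insert C \<C>"]) (auto simp: card_insert_if)
qed

text \<open>The set \<open>D\<close> may be simpler than \<open>A\<close>: only pieces that matter
  along the ray are charged. This is what saves one region for the third arm of a V.\<close>

lemma cuts_ray: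
  assumes "closed A" "u \<noteq> 0" "convex_union k D"
    and eq: "ray p u \<inter> A = ray p u \<inter> D"
  shows "cuts k A (A \<union> ray p u)"
proof -
  obtain \<D> where D: "finite \<D>" "card \<D> \<le> k" "\<forall>C\<in>\<D>. closed C \<and> convex C" "D = \<Union>\<D>"
    using assms(3) unfolding convex_union_def by blast
  let ?T = "(\<lambda>C. {0..} \<inter> along p u -` C) ` \<D>"
  show ?thesis unfolding ray_eq_along
  proof (rule cuts_ray_param[OF assms(2,1)])
    show "finite ?T" using D by simp
    show "card ?T \<le> k" using D(1,2) card_image_le le_trans by blast
    show "closed I \<and> convex I" if "I \<in> ?T" for I
      using that D(3) along_vimage by (auto intro!: convex_Int)
    show "{t \<in> {0..}. along p u t \<in> A} = \<Union>?T"
      using eq unfolding ray_eq_along D(4) by blast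
  qed
qed

text \<open>The attached end \<open>q\<close> has parameter 1, so \<open>k + 1\<close> pieces cost
  only \<open>k\<close>.\<close>

lemma cuts_segment:
  assumes A: "convex_union (Suc k) A" and "p \<noteq> q" "q \<in> A"
  shows "cuts k A (A \<union> closed_segment p q)"
proof -
  obtain \<D> where D: "finite \<D>" "card \<D> \<le> Suc k" "\<forall>C\<in>\<D>. closed C \<and> convex C" "A = \<Union>\<D>"
    using A unfolding convex_union_def by blast
  let ?T = "(\<lambda>C. {0..1} \<inter> along p (q - p) -` C) ` \<D>"
  show ?thesis unfolding closed_segment_eq_along
  proof (rule cuts_segment_param)
    show "closed A" using A by (rule convex_union_closed)
    show "finite ?T" using D by simp
    show "card ?T \<le> Suc k" using D(1,2) card_image_le le_trans by blast
    show "closed I \<and> convex I" if "I \<in> ?T" for I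
      using that D(3) along_vimage by (auto intro!: convex_Int)
    show *: "{t \<in> {0..1}. along p (q - p) t \<in> A} = \<Union>?T"
      unfolding D(4) by blast
    have "1 \<in> {t \<in> {0..1}. along p (q - p) t \<in> A}" using assms by simp
    then show "1 \<in> \<Union>?T" unfolding * .
  qed (use assms in auto)
qed

section \<open>The upper bound\<close>

lemma ray_closed_convex:
  assumes "u \<noteq> 0"
  shows "closed (ray p u)" "convex (ray p u)"
proof -
  show "closed (ray p u)" unfolding ray_eq_along using assms by (intro along_image_closed) auto
  have "ray p u = (+) p ` ((\<lambda>t. t *\<^sub>R u) ` {0..})" by (simp add: ray_eq_along image_image)
  then show "convex (ray p u)"
    by (simp add: convex_translation convex_linear_image linear_scaleR_left)
qed

lemma convex_union_ray: "convex_union k A \<Longrightarrow> u \<noteq> 0 \<Longrightarrow> convex_union (Suc k) (A \<union> ray p u)"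
  by (simp add: convex_union_Un ray_closed_convex)

lemma base_in_ray: "p \<in> ray p u"
  unfolding ray_def by (force intro: exI[of _ 0])

text \<open>A second common point makes \<open>w\<close> a nonnegative multiple of \<open>u\<close>.
  Hence two arms of a V meet only in the tip or one contains the other.\<close>

lemma ray_subset:
  assumes "z \<in> ray p u" "z \<in> ray p w" "z \<noteq> p"
  shows "ray p w \<subseteq> ray p u"
proof -
  obtain s t where s: "s \<ge> 0" "z = p + s *\<^sub>R u" and t: "t \<ge> 0" "z = p + t *\<^sub>R w"
    using assms(1,2) unfolding ray_def by blast
  then have "t > 0" using assms(3) by (cases "t = 0") auto
  have "t *\<^sub>R w = s *\<^sub>R u" using s t by simp
  then have "(1 / t) *\<^sub>R (t *\<^sub>R w) = (1 / t) *\<^sub>R (s *\<^sub>R u)" by simp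
  then have w: "w = (s / t) *\<^sub>R u" using \<open>t > 0\<close> by simp
  show ?thesis
  proof
    fix y assume "y \<in> ray p w"
    then obtain r where r: "r \<ge> 0" "y = p + r *\<^sub>R w" by (auto simp: ray_def)
    then have "y = p + (r * (s / t)) *\<^sub>R u" using w by simp
    moreover have "r * (s / t) \<ge> 0" using r s \<open>t > 0\<close> by simp
    ultimately show "y \<in> ray p u" unfolding ray_def by blast
  qed
qed

text \<open>Each of the three pieces is charged once per old piece; the 2 is the charge for the
  pieces of the shape meeting each other. Keeping \<open>convex_union\<close> in the conclusion lets
  the estimate be iterated.\<close>

definition cuts_like_three_pieces :: "(real^2) set \<Rightarrow> bool" where
  "cuts_like_three_pieces S \<longleftrightarrow> (\<forall>k A. convex_union k A \<longrightarrow>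
     convex_union (k + 3) (A \<union> S) \<and> cuts (3 * k + 2) A (A \<union> S))"

lemma three_armed_V_cuts:
  assumes "S \<in> three_armed_Vs"
  shows "cuts_like_three_pieces S"
  unfolding cuts_like_three_pieces_def
proof (intro allI impI)
  fix k A assume A: "convex_union k A"
  obtain p u v w where S: "S = ray p u \<union> ray p v \<union> ray p w" and nz: "u \<noteq> 0" "v \<noteq> 0" "w \<noteq> 0"
    using assms by (auto simp: three_armed_Vs_def)
  let ?A1 = "A \<union> ray p u" let ?A2 = "?A1 \<union> ray p v" let ?A3 = "?A2 \<union> ray p w"
  have eq: "A \<union> S = ?A3" using S by auto
  have 1: "convex_union (Suc k) ?A1" using A nz by (simp add: convex_union_ray)
  have 2: "convex_union (Suc (Suc k)) ?A2" using 1 nz by (simp add: convex_union_ray)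
  have 3: "convex_union (Suc (Suc (Suc k))) ?A3" using 2 nz by (simp add: convex_union_ray)
  have c1: "cuts k A ?A1" using convex_union_closed[OF A] nz A by (intro cuts_ray) auto
  have c2: "cuts (Suc k) ?A1 ?A2" using convex_union_closed[OF 1] nz 1 by (intro cuts_ray) auto
  \<comment> \<open>The third arm meets the union of the first two in the tip alone, unless it is contained in one.\<close>
  have c3: "cuts (Suc k) ?A2 ?A3"
  proof (cases "ray p w \<subseteq> ray p u")
    case True
    then have "?A3 = ?A2" by blast
    then show ?thesis by simp
  next
    case False
    then have "ray p w \<inter> ray p u \<subseteq> {p}" using ray_subset[of _ p u w] by blast
    then have "ray p w \<inter> ?A2 = ray p w \<inter> (A \<union> ray p v)" using base_in_ray[of p v] by auto
    moreover have "convex_union (Suc k) (A \<union> ray p v)"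
      using A nz by (simp add: convex_union_ray)
    ultimately show ?thesis
      using convex_union_closed[OF 2] nz by (intro cuts_ray)
  qed
  have "cuts (k + Suc k + Suc k) A ?A3" using c1 c2 c3 cuts_trans by blast
  then show "convex_union (k + 3) (A \<union> S) \<and> cuts (3 * k + 2) A (A \<union> S)"
    using 3 unfolding eq by (auto simp: numeral_3_eq_3 elim!: cuts_mono)
qed

text \<open>The segment runs from \<open>q\<close> to its attached end \<open>p\<close>, which
  offsets the first ray as an additional piece. The last ray can meet both the segment and the first
  ray, whence \<open>k + 2\<close> and the total \<open>3 * k + 2\<close>.\<close>

lemma three_chain_cuts:
  assumes "S \<in> three_chains"
  shows "cuts_like_three_pieces S"
  unfolding cuts_like_three_pieces_def
proof (intro allI impI)
  fix k A assume A: "convex_union k A"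
  obtain p q u v where S: "S = ray p u \<union> closed_segment p q \<union> ray q v"
    and nz: "u \<noteq> 0" "v \<noteq> 0" "p \<noteq> q"
    using assms by (auto simp: three_chains_def)
  let ?A1 = "A \<union> ray p u" let ?A2 = "?A1 \<union> closed_segment q p" let ?A3 = "?A2 \<union> ray q v"
  have eq: "A \<union> S = ?A3" using S by (auto simp: closed_segment_commute)
  have 1: "convex_union (Suc k) ?A1" using A nz by (simp add: convex_union_ray)
  have 2: "convex_union (Suc (Suc k)) ?A2" using 1 by (simp add: convex_union_Un)
  have 3: "convex_union (Suc (Suc (Suc k))) ?A3" using 2 nz by (simp add: convex_union_ray)
  have c1: "cuts k A ?A1" using convex_union_closed[OF A] nz A by (intro cuts_ray) auto
  have c2: "cuts k ?A1 ?A2" using nz 1 base_in_ray[of p u] by (intro cuts_segment) auto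
  have c3: "cuts (Suc (Suc k)) ?A2 ?A3" using convex_union_closed[OF 2] nz 2 by (intro cuts_ray) auto
  have "cuts (k + k + Suc (Suc k)) A ?A3" using c1 c2 c3 cuts_trans by blast
  then show "convex_union (k + 3) (A \<union> S) \<and> cuts (3 * k + 2) A (A \<union> S)"
    using 3 unfolding eq by (auto simp: numeral_3_eq_3 elim!: cuts_mono)
qed

text \<open>The crossbar comes last, when its end \<open>b\<close> already lies on a leg:
  \<open>k + 2\<close> pieces then cost \<open>k + 1\<close>, and so does the second leg.\<close>

lemma long_legged_A_cuts:
  assumes "S \<in> long_legged_As"
  shows "cuts_like_three_pieces S"
  unfolding cuts_like_three_pieces_def
proof (intro allI impI)
  fix k A assume A: "convex_union k A"
  obtain p u v a b where S: "S = ray p u \<union> ray p v \<union> closed_segment a b"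
    and nz: "u \<noteq> 0" "v \<noteq> 0" "a \<noteq> b" and ab: "a \<in> ray p u" "b \<in> ray p v"
    using assms by (auto simp: long_legged_As_def)
  let ?A1 = "A \<union> ray p u" let ?A2 = "?A1 \<union> ray p v" let ?A3 = "?A2 \<union> closed_segment a b"
  have eq: "A \<union> S = ?A3" using S by auto
  have 1: "convex_union (Suc k) ?A1" using A nz by (simp add: convex_union_ray)
  have 2: "convex_union (Suc (Suc k)) ?A2" using 1 nz by (simp add: convex_union_ray)
  have 3: "convex_union (Suc (Suc (Suc k))) ?A3" using 2 by (simp add: convex_union_Un)
  have c1: "cuts k A ?A1" using convex_union_closed[OF A] nz A by (intro cuts_ray) auto
  have c2: "cuts (Suc k) ?A1 ?A2" using convex_union_closed[OF 1] nz 1 by (intro cuts_ray) auto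
  have c3: "cuts (Suc k) ?A2 ?A3" using nz 2 ab by (intro cuts_segment) auto
  have "cuts (k + Suc k + Suc k) A ?A3" using c1 c2 c3 cuts_trans by blast
  then show "convex_union (k + 3) (A \<union> S) \<and> cuts (3 * k + 2) A (A \<union> S)"
    using 3 unfolding eq by (auto simp: numeral_3_eq_3 elim!: cuts_mono)
qed

text \<open>The empty drawing has one region, and shape number \<open>m\<close> is charged
  \<open>9 * m + 2\<close> because \<open>m\<close> shapes have \<open>3 * m\<close> pieces. The sum
  is stated without division or subtraction to stay in the naturals.\<close>

lemma regions_upper_bound:
  assumes "\<And>i. i < n \<Longrightarrow> cuts_like_three_pieces (S i)"
  shows "finite (regions n S)" "2 * card (regions n S) + 5 * n \<le> 9 * n ^ 2 + 2"
proof -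
  have "convex_union (3 * n) (\<Union>i<n. S i) \<and> finite (components (- (\<Union>i<n. S i))) \<and>
    2 * card (components (- (\<Union>i<n. S i))) + 5 * n \<le> 9 * n ^ 2 + 2"
    using assms
  proof (induction n)
    case 0
    have "components (UNIV :: (real^2) set) = {UNIV}"
      by (simp add: components_eq_sing_iff)
    then show ?case by (simp add: convex_union_empty)
  next
    case (Suc n)
    let ?A = "\<Union>i<n. S i"
    have IH: "convex_union (3 * n) ?A" "finite (components (- ?A))"
      "2 * card (components (- ?A)) + 5 * n \<le> 9 * n ^ 2 + 2" using Suc by auto
    have un: "(\<Union>i<Suc n. S i) = ?A \<union> S n" by (auto simp: less_Suc_eq)
    have st: "convex_union (3 * n + 3) (?A \<union> S n)" "cuts (3 * (3 * n) + 2) ?A (?A \<union> S n)"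
      using Suc.prems[of n] IH(1) unfolding cuts_like_three_pieces_def by blast+
    then have "finite (components (- (?A \<union> S n)))"
      "card (components (- (?A \<union> S n))) \<le> card (components (- ?A)) + (3 * (3 * n) + 2)"
      using IH(2) unfolding cuts_def by blast+
    moreover have "9 * (Suc n)^2 = 9 * n^2 + 18 * n + 9" by (simp add: power2_eq_square)
    ultimately show ?case using st(1) IH(3) unfolding un by (simp add: add.commute)
  qed
  then show "finite (regions n S)" "2 * card (regions n S) + 5 * n \<le> 9 * n ^ 2 + 2"
    by (simp_all add: regions_def Compl_eq_Diff_UNIV)
qed

section \<open>Extending pieces to full lines\<close>

text \<open>For a nonempty interval of parameters, each side on which it is bounded is a missing
  half-line.\<close>

definition ends :: "real set \<Rightarrow> nat" where
  "ends I = of_bool (bdd_below I) + of_bool (bdd_above I)"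

text \<open>The missing parts \<open>L\<close> and \<open>R\<close> below and above \<open>I\<close>
  avoid \<open>A\<close>, so each is one gap and is charged 1 if it is present.\<close>

lemma cuts_extend_line:
  assumes A: "closed A" and v: "v \<noteq> 0" and I: "closed I" "convex I" "I \<noteq> {}"
    and sub: "along p v ` I \<subseteq> A" and disj: "along p v ` (- I) \<inter> A = {}"
  shows "cuts (ends I) A (A \<union> range (along p v))"
proof -
  let ?f = "along p v"
  define L where "L = {t. \<forall>s\<in>I. t < s}"
  define R where "R = {t. \<forall>s\<in>I. s < t}"
  have LR: "- I = L \<union> R"
  proof -
    have "t \<in> L \<union> R" if "t \<notin> I" for t
    proof (rule ccontr)
      assume "t \<notin> L \<union> R"
      then obtain s s' where "s \<in> I" "s' \<in> I" "s \<le> t" "t \<le> s'"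
        by (auto simp: L_def R_def not_less)
      then have "t \<in> I"
        using I(2) by (meson is_interval_1 is_interval_convex_1)
      then show False using that by simp
    qed
    then show ?thesis by (auto simp: L_def R_def)
  qed
  have dj: "L \<inter> I = {}" "R \<inter> I = {}" "L \<inter> R = {}" using I(3) by (auto simp: L_def R_def) force
  have L_eq: "L = (if bdd_below I then {..<Inf I} else {})"
  proof (cases "bdd_below I")
    case True
    then show ?thesis
      using I closed_contains_Inf[of I] cInf_lower[of _ I] by (force simp: L_def)
  next
    case False
    have "bdd_below I" if "t \<in> L" for t
      unfolding bdd_below_def using that by (auto simp: L_def intro!: exI[of _ t] less_imp_le)
    then show ?thesis using False by auto
  qed
  have R_eq: "R = (if bdd_above I then {Sup I<..} else {})"
  proof (cases "bdd_above I")
    case True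
    then show ?thesis
      using I closed_contains_Sup[of I] cSup_upper[of _ I] by (force simp: R_def)
  next
    case False
    have "bdd_above I" if "t \<in> R" for t
      unfolding bdd_above_def using that by (auto simp: R_def intro!: exI[of _ t] less_imp_le)
    then show ?thesis using False by auto
  qed
  have "open L" "open R" "connected L" "connected R" by (auto simp: L_eq R_eq)
  \<comment> \<open>\<open>L\<close> itself is open; adding the already drawn part over
    \<open>I\<close> turns it into the closed set \<open>- R\<close>.\<close>
  have cl1: "closed (A \<union> ?f ` L)"
  proof -
    have "A \<union> ?f ` L = A \<union> ?f ` (- R)" using sub LR dj by blast
    moreover have "closed (?f ` (- R))" using v \<open>open R\<close> by (intro along_image_closed) auto
    ultimately show ?thesis using A by (simp only: closed_Un)
  qed
  have cl2: "closed (A \<union> ?f ` L \<union> ?f ` R)"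
  proof -
    have "A \<union> ?f ` L \<union> ?f ` R = A \<union> ?f ` UNIV" using sub LR by blast
    moreover have "closed (?f ` UNIV)" using v by (intro along_image_closed) auto
    ultimately show ?thesis using A by (simp only: closed_Un)
  qed
  have "cuts (of_bool (bdd_below I)) A (A \<union> ?f ` L)"
  proof (cases "bdd_below I")
    case True
    have "?f ` L \<inter> A = {}" using disj LR by blast
    then show ?thesis using True cuts_gap(1)[OF A v \<open>connected L\<close> _ cl1] by simp
  qed (simp add: L_eq)
  moreover have "cuts (of_bool (bdd_above I)) (A \<union> ?f ` L) (A \<union> ?f ` L \<union> ?f ` R)"
  proof (cases "bdd_above I")
    case True
    have "?f ` R \<inter> ?f ` L = {}" using dj v by auto
    then have "?f ` R \<inter> (A \<union> ?f ` L) = {}" using disj LR by blast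
    then show ?thesis using True cuts_gap(1)[OF cl1 v \<open>connected R\<close> _ cl2] by simp
  qed (simp add: R_eq)
  moreover have "A \<union> ?f ` L \<union> ?f ` R = A \<union> range ?f" using sub LR by blast
  ultimately show ?thesis unfolding ends_def using cuts_trans by metis
qed

text \<open>The parameter is the abscissa, so two such lines can meet only at equal
  parameters.\<close>

abbreviation on_line :: "real \<Rightarrow> real \<Rightarrow> real \<Rightarrow> real^2" where
  "on_line a b \<equiv> along (vector [0, b]) (vector [1, a])"

lemma on_line_nth [simp]: "on_line a b x $ 1 = x" "on_line a b x $ 2 = a * x + b"
  by simp_all

lemma slope_vector_nonzero [simp]: "(vector [1, a] :: real^2) \<noteq> 0"
proof
  assume "(vector [1, a] :: real^2) = 0"
  then have "(vector [1, a] :: real^2) $ 1 = 0" by simp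
  then show False by simp
qed

lemma on_line_eq_iff: "on_line a b x = on_line a' b' x' \<longleftrightarrow> x = x' \<and> a * x + b = a' * x' + b'"
  unfolding vec_eq_iff forall_2 on_line_nth ..

lemma in_range_on_line: "z \<in> range (on_line a b) \<longleftrightarrow> z $ 2 = a * z $ 1 + b"
proof
  assume "z $ 2 = a * z $ 1 + b"
  then have "z = on_line a b (z $ 1)" unfolding vec_eq_iff forall_2 on_line_nth by simp
  then show "z \<in> range (on_line a b)" by blast
qed (auto simp del: vector_add_component vector_scaleR_component)

text \<open>All crossings lie in the parts already drawn, so each missing end of a line is a single gap.\<close>

lemma cuts_extend_lines:
  fixes a b :: "nat \<Rightarrow> real" and I :: "nat \<Rightarrow> real set"
  assumes I: "\<And>k. k < m \<Longrightarrow> closed (I k) \<and> convex (I k) \<and> I k \<noteq> {}"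
    and cross: "\<And>k k' x. k < m \<Longrightarrow> k' < m \<Longrightarrow> k \<noteq> k' \<Longrightarrow> a k * x + b k = a k' * x + b k' \<Longrightarrow> x \<in> I k"
  shows "cuts (\<Sum>k<m. ends (I k)) (\<Union>k<m. on_line (a k) (b k) ` I k) (\<Union>k<m. range (on_line (a k) (b k)))"
proof -
  \<comment> \<open>Interpolates between the drawing and the arrangement: the first \<open>j\<close>
    lines are complete, the others still truncated.\<close>
  define B where "B j = (\<Union>k<j. range (on_line (a k) (b k))) \<union> (\<Union>k\<in>{j..<m}. on_line (a k) (b k) ` I k)" for j
  have "cuts (\<Sum>k<j. ends (I k)) (B 0) (B j)" if "j \<le> m" for j
    using that
  proof (induction j)
    case (Suc j)
    let ?f = "on_line (a j) (b j)"
    have "cuts (ends (I j)) (B j) (B j \<union> range ?f)"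
    proof (rule cuts_extend_line)
      show "closed (B j)" unfolding B_def using I Suc.prems
        by (intro closed_Un closed_UN ballI along_image_closed) auto
      show "closed (I j)" "convex (I j)" "I j \<noteq> {}" using I[of j] Suc.prems by auto
      show "?f ` I j \<subseteq> B j" unfolding B_def using Suc.prems by fastforce
      show "?f ` (- I j) \<inter> B j = {}"
      proof (rule ccontr)
        assume "?f ` (- I j) \<inter> B j \<noteq> {}"
        then obtain x where x: "x \<notin> I j" "?f x \<in> B j" by blast
        then consider k y where "k < j" "?f x = on_line (a k) (b k) y"
          | k y where "j \<le> k" "k < m" "y \<in> I k" "?f x = on_line (a k) (b k) y"
          unfolding B_def by fastforce
        then obtain k y where k: "k < m" "k \<noteq> j" "?f x = on_line (a k) (b k) y"
        proof cases
          case 1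
          then show thesis using Suc.prems by (intro that[of k y]) auto
        next
          case 2
          then have "k \<noteq> j" using x(1) by (auto simp: on_line_eq_iff)
          then show thesis using 2 that by blast
        qed
        then have "a j * x + b j = a k * x + b k" unfolding on_line_eq_iff by blast
        then show False using cross[of j k x] k x(1) Suc.prems by auto
      qed
    qed simp
    moreover have "B j \<union> range ?f = B (Suc j)"
    proof -
      have "{j..<m} = insert j {Suc j..<m}" using Suc.prems by auto
      then show ?thesis unfolding B_def lessThan_Suc by auto
    qed
    ultimately show ?case using Suc cuts_trans by fastforce
  qed simp
  from this[of m] show ?thesis by (simp add: B_def lessThan_atLeast0)
qed

section \<open>Points between the crossings on a line\<close>

text \<open>One point is chosen in each of the open intervals into which \<open>X\<close> cuts the
  line. The bound \<open>u\<close> is there for the induction: when a new maximum \<open>b\<close>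
  is added, the old points stay below \<open>b\<close> and one more fits between \<open>b\<close>
  and \<open>u\<close>.\<close>

lemma interleaving_points:
  fixes X :: "real set"
  assumes "finite X"
  shows "\<forall>u. (\<forall>x\<in>X. x < u) \<longrightarrow> (\<exists>Y. finite Y \<and> card Y = card X + 1 \<and> Y \<inter> X = {} \<and> (\<forall>y\<in>Y. y < u) \<and>
           (\<forall>y\<in>Y. \<forall>y'\<in>Y. y < y' \<longrightarrow> (\<exists>x\<in>X. y < x \<and> x < y')))"
  using assms
proof (induction X rule: finite_linorder_max_induct)
  case empty
  show ?case
  proof (intro allI impI)
    fix u :: real
    show "\<exists>Y. finite Y \<and> card Y = card ({}::real set) + 1 \<and> Y \<inter> {} = {} \<and> (\<forall>y\<in>Y. y < u) \<and>
           (\<forall>y\<in>Y. \<forall>y'\<in>Y. y < y' \<longrightarrow> (\<exists>x\<in>{}. y < x \<and> x < y'))"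
      by (intro exI[of _ "{u - 1}"]) auto
  qed
next
  case (insert b X)
  show ?case
  proof (intro allI impI)
    fix u assume u: "\<forall>x\<in>insert b X. x < u"
    obtain Y where Y: "finite Y" "card Y = card X + 1" "Y \<inter> X = {}" "\<forall>y\<in>Y. y < b"
      "\<forall>y\<in>Y. \<forall>y'\<in>Y. y < y' \<longrightarrow> (\<exists>x\<in>X. y < x \<and> x < y')"
      using insert.IH[THEN spec, THEN mp, OF insert.hyps(2)] by (elim exE conjE) (rule that)
    define w where "w = (b + u) / 2"
    have w: "b < w" "w < u" using u by (auto simp: w_def)
    have wX: "w \<notin> Y" "w \<notin> X" "w \<noteq> b" "b \<notin> X" "b \<notin> Y" using Y(4) insert.hyps(2) w by fastforce+
    show "\<exists>Y. finite Y \<and> card Y = card (insert b X) + 1 \<and> Y \<inter> insert b X = {} \<and> (\<forall>y\<in>Y. y < u) \<and>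
           (\<forall>y\<in>Y. \<forall>y'\<in>Y. y < y' \<longrightarrow> (\<exists>x\<in>insert b X. y < x \<and> x < y'))"
    proof (intro exI[of _ "insert w Y"] conjI)
      show "card (insert w Y) = card (insert b X) + 1" using Y wX insert.hyps by simp
      show "insert w Y \<inter> insert b X = {}" using Y wX by auto
      show "\<forall>y\<in>insert w Y. y < u" using Y w by force
      show "\<forall>y\<in>insert w Y. \<forall>y'\<in>insert w Y. y < y' \<longrightarrow> (\<exists>x\<in>insert b X. y < x \<and> x < y')"
      proof (intro ballI impI)
        fix y y' assume y: "y \<in> insert w Y" "y' \<in> insert w Y" "y < y'"
        have "y \<in> Y"
          using y w Y(4) by (metis insert_iff less_asym less_trans)
        then show "\<exists>x\<in>insert b X. y < x \<and> x < y'"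
          using y Y(4,5) w by (cases "y' = w") auto
      qed
    qed (use Y in auto)
  qed
qed

lemma card_values_between_crossings:
  fixes X :: "real set" and F :: "real \<Rightarrow> 'b"
  assumes "finite X" "finite (F ` (- X))"
    and sep: "\<And>y x y'. y < x \<Longrightarrow> x < y' \<Longrightarrow> x \<in> X \<Longrightarrow> y \<notin> X \<Longrightarrow> y' \<notin> X \<Longrightarrow> F y \<noteq> F y'"
  shows "card X + 1 \<le> card (F ` (- X))"
proof -
  obtain u where "\<forall>x\<in>X. x < u"
    using assms(1) by (metis bdd_above_finite bdd_above_def gt_ex le_less_trans)
  from interleaving_points[OF assms(1), THEN spec, THEN mp, OF this]
  obtain Y where Y: "finite Y" "card Y = card X + 1" "Y \<inter> X = {}"
      "\<forall>y\<in>Y. \<forall>y'\<in>Y. y < y' \<longrightarrow> (\<exists>x\<in>X. y < x \<and> x < y')"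
    by (elim exE conjE) (rule that)
  have "inj_on F Y"
  proof (rule linorder_inj_onI)
    fix y y' assume y: "y < y'" "y \<in> Y" "y' \<in> Y"
    then obtain x where "x \<in> X" "y < x" "x < y'" using Y(4) by blast
    then show "F y \<noteq> F y'" using sep[of y x y'] y Y(3) by blast
  qed (rule linear)
  then have "card Y = card (F ` Y)" by (simp add: card_image)
  also have "\<dots> \<le> card (F ` (- X))" using assms(2) Y(3) by (intro card_mono) auto
  finally show ?thesis using Y(2) by simp
qed

section \<open>Counting the regions of a line arrangement\<close>

definition lines_below :: "(nat \<Rightarrow> real) \<Rightarrow> (nat \<Rightarrow> real) \<Rightarrow> nat \<Rightarrow> real \<Rightarrow> real \<Rightarrow> nat set" where
  "lines_below a b m x y = {k. k < m \<and> a k * x + b k < y}"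

text \<open>A combinatorial stand-in for the regions: the set of lines below a point is constant on
  each region of the arrangement.\<close>

definition sign_sets :: "(nat \<Rightarrow> real) \<Rightarrow> (nat \<Rightarrow> real) \<Rightarrow> nat \<Rightarrow> nat set set" where
  "sign_sets a b m = {lines_below a b m x y | x y. \<forall>k<m. y \<noteq> a k * x + b k}"

text \<open>A set of abscissae on line \<open>m\<close>, so several earlier lines through one point
  of it count once.\<close>

definition crossings :: "(nat \<Rightarrow> real) \<Rightarrow> (nat \<Rightarrow> real) \<Rightarrow> nat \<Rightarrow> real set" where
  "crossings a b m = {x. \<exists>k<m. a k * x + b k = a m * x + b m}"

lemma finite_sign_sets: "finite (sign_sets a b m)"
  by (rule finite_subset[of _ "Pow {..<m}"]) (auto simp: sign_sets_def lines_below_def)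

lemma crossings_eq:
  assumes "\<And>k. k < m \<Longrightarrow> a k \<noteq> a m"
  shows "crossings a b m = (\<lambda>k. (b k - b m) / (a m - a k)) ` {..<m}"
proof -
  have "a k * x + b k = a m * x + b m \<longleftrightarrow> x = (b k - b m) / (a m - a k)" if "k < m" for k x
    using assms[OF that] by (auto simp: field_simps)
  then show ?thesis unfolding crossings_def by auto
qed

text \<open>\<open>P\<close> and \<open>Q\<close> are the traces on the first \<open>m\<close> lines
  of cells below and above line \<open>m\<close>. Their union contains all old sign sets, and their
  intersection those of the cells that line \<open>m\<close> runs through, at least one for each
  interval between its crossings. The claim is
  \<open>card P + card Q = card (P \<union> Q) + card (P \<inter> Q)\<close>.\<close>

lemma card_sign_sets_Suc:
  assumes slopes: "\<And>k. k < m \<Longrightarrow> a k \<noteq> a m"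
  shows "card (sign_sets a b m) + (card (crossings a b m) + 1) \<le> card (sign_sets a b (Suc m))"
proof -
  let ?V = "sign_sets a b m" and ?V' = "sign_sets a b (Suc m)" and ?X = "crossings a b m"
  define F where "F x = lines_below a b m x (a m * x + b m)" for x
  define P where "P = {v. v \<subseteq> {..<m} \<and> v \<in> ?V'}"
  define Q where "Q = {v. v \<subseteq> {..<m} \<and> insert m v \<in> ?V'}"
  have fin: "finite P" "finite Q" "finite (P \<union> Q)"
    by (rule finite_subset[of _ "Pow {..<m}"], auto simp: P_def Q_def)+
  have FPQ: "F x \<in> P \<inter> Q" if "x \<notin> ?X" for x
  proof -
    define y where "y = a m * x + b m"
    \<comment> \<open>Moving vertically by less than every distance in \<open>G\<close> passes no
      other line. The 1 keeps \<open>Min\<close> meaningful if there is no other line.\<close>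
    define G where "G = insert 1 ((\<lambda>k. \<bar>y - (a k * x + b k)\<bar>) ` {..<m})"
    define e where "e = Min G / 2"
    have "finite G" "G \<noteq> {}" by (auto simp: G_def)
    moreover have "\<forall>g\<in>G. g > 0" using that by (auto simp: G_def crossings_def y_def)
    ultimately have "Min G > 0" by simp
    then have e: "e > 0" "e < Min G" by (auto simp: e_def)
    have far: "e < \<bar>y - (a k * x + b k)\<bar>" if "k < m" for k
      using e(2) Min_le[of G "\<bar>y - (a k * x + b k)\<bar>"] that by (auto simp: G_def)
    have Fx: "F x \<subseteq> {..<m}" by (auto simp: F_def lines_below_def)
    have low: "lines_below a b (Suc m) x (y - e) = F x"
      using far e(1) by (force simp: lines_below_def F_def less_Suc_eq y_def[symmetric])
    have up: "lines_below a b (Suc m) x (y + e) = insert m (F x)"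
      using far e(1) by (force simp: lines_below_def F_def less_Suc_eq y_def[symmetric])
    have "\<forall>k<Suc m. y - e \<noteq> a k * x + b k" "\<forall>k<Suc m. y + e \<noteq> a k * x + b k"
      using far e(1) by (force simp: less_Suc_eq y_def[symmetric])+
    then have "lines_below a b (Suc m) x (y - e) \<in> ?V'" "lines_below a b (Suc m) x (y + e) \<in> ?V'"
      unfolding sign_sets_def by blast+
    then have "F x \<in> ?V'" "insert m (F x) \<in> ?V'" unfolding low up .
    then show ?thesis using Fx by (simp add: P_def Q_def)
  qed
  have "?V \<subseteq> P \<union> Q"
  proof
    fix v assume "v \<in> ?V"
    then obtain x y where v: "v = lines_below a b m x y" and off: "\<forall>k<m. y \<noteq> a k * x + b k"
      by (auto simp: sign_sets_def)
    have vm: "v \<subseteq> {..<m}" by (auto simp: v lines_below_def)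
    show "v \<in> P \<union> Q"
    proof (cases "y = a m * x + b m")
      case True
      then have "x \<notin> ?X" "v = F x" using off by (force simp: crossings_def, simp add: F_def v)
      then show ?thesis using FPQ by blast
    next
      case False
      then have in_V': "lines_below a b (Suc m) x y \<in> ?V'"
        unfolding sign_sets_def using off less_Suc_eq by auto
      show ?thesis
      proof (cases "a m * x + b m < y")
        case True
        then have "lines_below a b (Suc m) x y = insert m v" by (auto simp: v lines_below_def)
        then show ?thesis using in_V' vm by (simp add: Q_def)
      next
        case False
        then have "lines_below a b (Suc m) x y = v" by (auto simp: v lines_below_def less_Suc_eq)
        then show ?thesis using in_V' vm by (simp add: P_def)
      qed
    qed
  qed
  then have 1: "card ?V \<le> card (P \<union> Q)" using fin by (intro card_mono)
  have "finite ?X" using slopes by (simp add: crossings_eq)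
  have FX: "F ` (- ?X) \<subseteq> P \<inter> Q" using FPQ by auto
  have "card ?X + 1 \<le> card (F ` (- ?X))"
  proof (rule card_values_between_crossings[OF \<open>finite ?X\<close>])
    show "finite (F ` (- ?X))" using FX fin by (meson finite_Int finite_subset)
    fix y x y' assume h: "y < x" "x < y'" "x \<in> ?X"
    then obtain k where k: "k < m" "a k * x + b k = a m * x + b m" by (auto simp: crossings_def)
    \<comment> \<open>The difference of the two lines changes sign at their crossing
      \<open>x\<close>, so line \<open>k\<close> lies below line \<open>m\<close> on exactly one
      side of it.\<close>
    have diff: "(a m * z + b m) - (a k * z + b k) = (a m - a k) * (z - x)" for z
      using k(2) by (simp add: algebra_simps)
    have iff: "k \<in> F z \<longleftrightarrow> (a m - a k) * (z - x) > 0" for z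
      using diff[of z] k(1) by (auto simp: F_def lines_below_def)
    have "k \<in> F y \<longleftrightarrow> k \<notin> F y'"
    proof (cases "a k < a m")
      case True
      then show ?thesis using h by (simp add: iff zero_less_mult_iff)
    next
      case False
      then have "a m < a k" using slopes[OF k(1)] by simp
      then show ?thesis using h by (simp add: iff zero_less_mult_iff)
    qed
    then show "F y \<noteq> F y'" by auto
  qed
  also have "\<dots> \<le> card (P \<inter> Q)" using FX fin by (intro card_mono) auto
  finally have 2: "card ?X + 1 \<le> card (P \<inter> Q)" .
  have "card (insert m ` Q) = card Q"
    by (intro card_image inj_onI) (auto simp: Q_def)
  then have "card P + card Q = card P + card (insert m ` Q)" by simp
  also have "\<dots> = card (P \<union> insert m ` Q)"
    using fin by (intro card_Un_disjoint[symmetric]) (auto simp: P_def)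
  also have "\<dots> \<le> card ?V'"
    by (intro card_mono finite_sign_sets) (auto simp: P_def Q_def)
  finally show ?thesis using 1 2 card_Un_Int[OF fin(1,2)] by linarith
qed

lemma card_sign_sets:
  assumes "\<And>k l. k < l \<Longrightarrow> l < m \<Longrightarrow> a k \<noteq> a l"
  shows "1 + (\<Sum>k<m. card (crossings a b k) + 1) \<le> card (sign_sets a b m)"
  using assms
proof (induction m)
  case 0
  have "sign_sets a b 0 = {{}}" by (auto simp: sign_sets_def lines_below_def)
  then show ?case by simp
next
  case (Suc m)
  then show ?case using card_sign_sets_Suc[of m a b] by fastforce
qed

text \<open>By the intermediate value theorem the height above line \<open>k\<close> keeps its sign
  on a connected set that avoids the line. So each region has one sign set, and every sign set is
  attained on some region.\<close>

lemma card_sign_sets_le_components: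
  fixes a b :: "nat \<Rightarrow> real" and m :: nat
  defines "U \<equiv> - (\<Union>k<m. range (on_line (a k) (b k)))"
  assumes fin: "finite (components U)"
  shows "card (sign_sets a b m) \<le> card (components U)"
proof -
  define g where "g z = lines_below a b m (z $ 1) (z $ 2)" for z :: "real^2"
  have U: "z \<in> U \<longleftrightarrow> (\<forall>k<m. z $ 2 \<noteq> a k * z $ 1 + b k)" for z
    unfolding U_def using in_range_on_line[of z] by auto
  have same: "g z = g z'" if C: "C \<in> components U" and z: "z \<in> C" "z' \<in> C" for C z z'
  proof -
    have one: "a k * z' $ 1 + b k < z' $ 2"
      if k: "k < m" and z: "z \<in> C" "z' \<in> C" "a k * z $ 1 + b k < z $ 2" for k z z'
    proof (rule ccontr)
      assume *: "\<not> a k * z' $ 1 + b k < z' $ 2"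
      define h where "h z = z $ 2 - (a k * z $ 1 + b k)" for z :: "real^2"
      have "connected (h ` C)"
        using C unfolding h_def by (intro connected_continuous_image continuous_intros)
          (auto dest: in_components_connected)
      moreover have "h z \<in> h ` C" "h z' \<in> h ` C" using z by auto
      ultimately have "0 \<in> h ` C"
        using z(3) * connected_contains_Icc[of "h ` C" "h z'" "h z"] by (auto simp: h_def)
      then obtain w where "w \<in> C" "h w = 0" by auto
      then show False using in_components_subset[OF C] U[of w] k by (auto simp: h_def)
    qed
    show ?thesis unfolding g_def lines_below_def using one z by blast
  qed
  have "sign_sets a b m \<subseteq> (\<lambda>C. g (SOME z. z \<in> C)) ` components U"
  proof
    fix v assume "v \<in> sign_sets a b m"
    then obtain x y where v: "v = lines_below a b m x y" "\<forall>k<m. y \<noteq> a k * x + b k"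
      by (auto simp: sign_sets_def)
    define z :: "real^2" where "z = vector [x, y]"
    have z: "z \<in> U" "v = g z" using v by (auto simp: U z_def g_def)
    define C where "C = connected_component_set U z"
    have C: "C \<in> components U" "z \<in> C" using z by (auto simp: C_def components_def)
    have "(SOME z. z \<in> C) \<in> C" using C(2) by (rule someI)
    then have "v = g (SOME z. z \<in> C)" using same[OF C(1)] C(2) z(2) by blast
    then show "v \<in> (\<lambda>C. g (SOME z. z \<in> C)) ` components U" using C(1) by blast
  qed
  then show ?thesis using fin by (rule surj_card_le[rotated])
qed

section \<open>The extremal configurations\<close>

lemma sum_lessThan_3: "sum f {..<3::nat} = f 0 + f 1 + f 2"
  by (simp add: numeral_3_eq_3 numeral_2_eq_2)

lemma sum_lessThan_3_mult:
  fixes f :: "nat \<Rightarrow> nat"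
  shows "sum f {..<3 * n} = (\<Sum>i<n. \<Sum>j<3. f (3 * i + j))"
proof (induction n)
  case (Suc n)
  have "{..<3 * Suc n} = {..<3 * n} \<union> {3 * n, 3 * n + 1, 3 * n + 2}" by auto
  then have "sum f {..<3 * Suc n} = sum f {..<3 * n} + sum f {3 * n, 3 * n + 1, 3 * n + 2}"
    by (simp only:) (intro sum.union_disjoint; auto)
  then show ?case using Suc by (simp add: sum_lessThan_3)
qed simp

text \<open>
  Cluster \<open>i\<close> consists of perturbations of the tangent \<open>y = 2 i x - i\<^sup>2\<close> to the parabola \<open>y = x\<^sup>2\<close>.
  The tangents \<open>i\<close> and \<open>i'\<close> meet above \<open>(i + i') / 2\<close>, so lines of two clusters still cross near
  that abscissa, whereas the lines of one cluster meet outside \<open>{1/4<..<n + 1}\<close>.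
\<close>

locale cluster_template =
  fixes n :: nat and \<alpha> \<beta> :: "nat \<Rightarrow> real" and I :: "nat \<Rightarrow> real set"
  assumes small: "\<And>j. j < 3 \<Longrightarrow> \<bar>\<alpha> j\<bar> \<le> 1 / (25 * (real n + 1)) \<and> \<bar>\<beta> j\<bar> \<le> 1 / (25 * (real n + 1))"
    and slopes: "\<And>j j'. j < 3 \<Longrightarrow> j' < 3 \<Longrightarrow> j \<noteq> j' \<Longrightarrow> \<alpha> j \<noteq> \<alpha> j'"
    and vertex: "\<And>j j' x. j < 3 \<Longrightarrow> j' < 3 \<Longrightarrow> j \<noteq> j' \<Longrightarrow> \<alpha> j * x + \<beta> j = \<alpha> j' * x + \<beta> j' \<Longrightarrow>
          x \<in> I j \<and> (x \<le> 1 / 4 \<or> x \<ge> real n + 1)"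
    and interval: "\<And>j. j < 3 \<Longrightarrow> closed (I j) \<and> convex (I j) \<and> {1 / 4..real n + 1} \<subseteq> I j"
begin

text \<open>Line \<open>j\<close> of cluster \<open>i\<close> has the number
  \<open>k = 3 * i + j\<close>; quotient and remainder recover the two indices.\<close>

definition a :: "nat \<Rightarrow> real" where "a k = 2 * real (k div 3) + \<alpha> (k mod 3)"
definition b :: "nat \<Rightarrow> real" where "b k = - (real (k div 3))\<^sup>2 + \<beta> (k mod 3)"
definition vertices :: "nat \<Rightarrow> real set" where
  "vertices j = {x. \<exists>j'<j. \<alpha> j' * x + \<beta> j' = \<alpha> j * x + \<beta> j}"
definition shape :: "nat \<Rightarrow> (real^2) set" where
  "shape i = (\<Union>j<3. on_line (2 * real i + \<alpha> j) (- (real i)\<^sup>2 + \<beta> j) ` I j)"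

text \<open>The unperturbed tangents cross at \<open>h\<close>, and
  \<open>2 * (i' - i) * (x - h)\<close> equals the perturbation \<open>?A * x + ?B\<close>. With
  coefficients bounded by \<open>2 * \<eta>\<close> and
  \<open>\<bar>x\<bar> \<le> \<bar>x - h\<bar> + n\<close>, the factor 25 makes
  \<open>\<bar>x - h\<bar>\<close> at most 1/24. The tolerance 1/4 is enough because, with one
  cluster fixed, the midpoints \<open>h\<close> are at least 1/2 apart.\<close>

lemma cross_near:
  assumes k: "k < 3 * n" "k' < 3 * n" "k div 3 \<noteq> k' div 3"
    and eq: "a k * x + b k = a k' * x + b k'"
  shows "\<bar>x - (real (k div 3) + real (k' div 3)) / 2\<bar> < 1 / 4"
proof -
  define i i' where "i = real (k div 3)" and "i' = real (k' div 3)"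
  define \<eta> where "\<eta> = 1 / (25 * (real n + 1))"
  define h where "h = (i + i') / 2"
  have i: "0 \<le> i" "i \<le> n" "0 \<le> i'" "i' \<le> n" using k by (auto simp: i_def i'_def)
  have d: "\<bar>i' - i\<bar> \<ge> 1" using k(3) by (simp add: i_def i'_def)
  have \<eta>: "\<eta> > 0" "\<eta> * (real n + 1) = 1 / 25" by (auto simp: \<eta>_def field_simps)
  have "\<eta> * 1 \<le> \<eta> * (real n + 1)" using \<eta>(1) by (intro mult_left_mono) auto
  then have \<eta>1: "\<eta> \<le> 1 / 25" using \<eta>(2) by simp
  let ?A = "\<alpha> (k mod 3) - \<alpha> (k' mod 3)" and ?B = "\<beta> (k mod 3) - \<beta> (k' mod 3)"
  have AB: "\<bar>?A\<bar> \<le> 2 * \<eta>" "\<bar>?B\<bar> \<le> 2 * \<eta>"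
    using small[of "k mod 3", folded \<eta>_def] small[of "k' mod 3", folded \<eta>_def]
    by (simp_all add: abs_le_iff)
  have "2 * x - (i + i') = 2 * (x - h)" by (simp add: h_def field_simps)
  then have "2 * (i' - i) * (x - h) = (i' - i) * (2 * x - (i + i'))"
    by (simp only: mult.assoc mult.left_commute)
  also have "\<dots> = ?A * x + ?B"
    using eq unfolding a_def b_def i_def[symmetric] i'_def[symmetric]
    by (simp add: power2_eq_square algebra_simps)
  finally have "2 * (i' - i) * (x - h) = ?A * x + ?B" .
  then have "2 * \<bar>i' - i\<bar> * \<bar>x - h\<bar> = \<bar>?A * x + ?B\<bar>" by (metis abs_mult abs_numeral)
  moreover have "2 * 1 * \<bar>x - h\<bar> \<le> 2 * \<bar>i' - i\<bar> * \<bar>x - h\<bar>"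
    using d by (intro mult_right_mono) auto
  ultimately have 1: "2 * \<bar>x - h\<bar> \<le> \<bar>?A * x + ?B\<bar>" by simp
  have "\<bar>?A * x\<bar> \<le> (2 * \<eta>) * \<bar>x\<bar>" unfolding abs_mult using AB by (intro mult_right_mono) auto
  also have "\<dots> \<le> (2 * \<eta>) * (\<bar>x - h\<bar> + n)"
  proof -
    have "0 \<le> h" "h \<le> n" using i by (auto simp: h_def)
    then have "\<bar>x\<bar> \<le> \<bar>x - h\<bar> + n" by linarith
    then show ?thesis using \<eta> by (intro mult_left_mono) auto
  qed
  finally have "\<bar>?A * x + ?B\<bar> \<le> (2 * \<eta>) * (\<bar>x - h\<bar> + n) + 2 * \<eta>"
    using AB(2) abs_triangle_ineq[of "?A * x" ?B] by linarith
  also have "\<dots> = 2 * \<eta> * \<bar>x - h\<bar> + 2 * (\<eta> * (real n + 1))" by (simp add: algebra_simps)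
  finally have "2 * \<bar>x - h\<bar> \<le> 2 * \<eta> * \<bar>x - h\<bar> + 2 * (\<eta> * (real n + 1))"
    using 1 by linarith
  moreover have "\<eta> * \<bar>x - h\<bar> \<le> 1 / 25 * \<bar>x - h\<bar>" using \<eta>1 by (intro mult_right_mono) auto
  ultimately have "\<bar>x - h\<bar> < 1 / 4" using \<eta>(2) by simp
  then show ?thesis by (simp add: h_def i_def i'_def)
qed

lemma cross_range:
  assumes k: "k < 3 * n" "k' < 3 * n" "k div 3 \<noteq> k' div 3"
    and eq: "a k * x + b k = a k' * x + b k'"
  shows "1 / 4 < x" "x < real n + 1"
proof -
  have "k div 3 < n" "k' div 3 < n" "k div 3 + k' div 3 \<ge> 1" using k by auto
  then have "real (k div 3) + real (k' div 3) \<le> 2 * n" "real (k div 3) + real (k' div 3) \<ge> 1"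
    by linarith+
  then show "1 / 4 < x" "x < real n + 1"
    using cross_near[OF assms] unfolding abs_less_iff add_divide_distrib by linarith+
qed

lemma same_cluster_cross:
  assumes "k div 3 = k' div 3"
  shows "a k * x + b k = a k' * x + b k' \<longleftrightarrow>
    \<alpha> (k mod 3) * x + \<beta> (k mod 3) = \<alpha> (k' mod 3) * x + \<beta> (k' mod 3)"
  using assms by (simp add: a_def b_def algebra_simps)

lemma same_cluster_mod:
  fixes k k' :: nat
  assumes "k div 3 = k' div 3" "k \<noteq> k'"
  shows "k mod 3 \<noteq> k' mod 3"
  using assms by (metis div_mult_mod_eq)

lemma same_cluster_cross_range:
  assumes "k div 3 = k' div 3" "k \<noteq> k'" "a k * x + b k = a k' * x + b k'"
  shows "x \<in> I (k mod 3)" "x \<le> 1 / 4 \<or> x \<ge> real n + 1"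
  using vertex[of "k mod 3" "k' mod 3" x] same_cluster_mod[OF assms(1,2)]
    assms(3)[unfolded same_cluster_cross[OF assms(1)]] by auto

lemma distinct_slopes:
  assumes "k \<noteq> k'"
  shows "a k \<noteq> a k'"
proof (cases "k div 3 = k' div 3")
  case True
  then show ?thesis using slopes[of "k mod 3" "k' mod 3"] same_cluster_mod[OF True assms]
    by (auto simp: a_def)
next
  case False
  then have "\<bar>real (k div 3) - real (k' div 3)\<bar> \<ge> 1" by simp
  moreover have le: "1 / (25 * (real n + 1)) \<le> 1 / 25" by (simp add: field_simps)
  have "\<bar>\<alpha> j\<bar> \<le> 1 / 25" if "j < 3" for j
    using small[OF that] le order_trans by blast
  then have "\<bar>\<alpha> (k mod 3)\<bar> \<le> 1 / 25" "\<bar>\<alpha> (k' mod 3)\<bar> \<le> 1 / 25" by simp_all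
  ultimately show ?thesis unfolding a_def by (auto simp: abs_if split: if_splits)
qed

lemma crossing_in_interval:
  assumes "k < 3 * n" "k' < 3 * n" "k \<noteq> k'" "a k * x + b k = a k' * x + b k'"
  shows "x \<in> I (k mod 3)"
proof (cases "k div 3 = k' div 3")
  case True
  then show ?thesis using same_cluster_cross_range assms by blast
next
  case False
  then have "x \<in> {1 / 4..real n + 1}" using cross_range[OF assms(1,2) False assms(4)] by simp
  then show ?thesis using interval[of "k mod 3"] by auto
qed

text \<open>The \<open>3 * (m div 3)\<close> crossings with earlier clusters are distinct: for two
  different clusters they lie in disjoint windows, and two lines of the same cluster cannot meet
  line \<open>m\<close> in one point, since they meet each other only outside the range of these
  crossings. For the same reason the vertices of the own cluster are new.\<close>

lemma card_crossings:
  assumes m: "m < 3 * n"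
  shows "3 * (m div 3) + card (vertices (m mod 3)) \<le> card (crossings a b m)"
proof -
  let ?i = "m div 3"
  define cr where "cr k = (b k - b m) / (a m - a k)" for k
  have cr: "a k * cr k + b k = a m * cr k + b m" if "k < m" for k
    using distinct_slopes[of k m] that by (auto simp: cr_def field_simps)
  have eq: "crossings a b m = cr ` {..<m}"
    unfolding cr_def using distinct_slopes by (intro crossings_eq) auto
  have lt: "k < m" "k div 3 \<noteq> ?i" if "k < 3 * ?i" for k using that by auto
  have rng: "1 / 4 < cr k" "cr k < real n + 1" if "k < 3 * ?i" for k
    using cross_range[of k m "cr k"] lt[OF that] cr m by auto
  have inj: "inj_on cr {..<3 * ?i}"
  proof (rule inj_onI, rule ccontr)
    fix k k' assume k: "k \<in> {..<3 * ?i}" "k' \<in> {..<3 * ?i}" "cr k = cr k'" "k \<noteq> k'"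
    have k': "k < 3 * ?i" "k' < 3 * ?i" using k by auto
    show False
    proof (cases "k div 3 = k' div 3")
      case True
      have "a k * cr k + b k = a k' * cr k + b k'"
        using cr[OF lt(1)[OF k'(1)]] cr[OF lt(1)[OF k'(2)]] k(3) by simp
      then have "cr k \<le> 1 / 4 \<or> cr k \<ge> real n + 1" by (rule same_cluster_cross_range(2)[OF True k(4)])
      then show False using rng[OF k'(1)] by auto
    next
      case False
      have "\<bar>cr k - (real (k div 3) + real ?i) / 2\<bar> < 1 / 4"
        using cross_near[of k m "cr k"] lt[OF k'(1)] cr m by auto
      moreover have "\<bar>cr k - (real (k' div 3) + real ?i) / 2\<bar> < 1 / 4"
        using cross_near[of k' m "cr k'"] lt[OF k'(2)] cr m k(3) by auto
      moreover have "\<bar>real (k div 3) - real (k' div 3)\<bar> \<ge> 1" using False by simp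
      ultimately show False by (auto simp: abs_if field_simps split: if_splits)
    qed
  qed
  have V: "vertices (m mod 3) \<subseteq> crossings a b m"
  proof
    fix x assume "x \<in> vertices (m mod 3)"
    then obtain j where j: "j < m mod 3" "\<alpha> j * x + \<beta> j = \<alpha> (m mod 3) * x + \<beta> (m mod 3)"
      by (auto simp: vertices_def)
    have "m mod 3 < 3" by simp
    then have "j < 3" using j(1) by linarith
    then have dm: "(3 * ?i + j) div 3 = ?i" "(3 * ?i + j) mod 3 = j" by auto
    then have "a (3 * ?i + j) * x + b (3 * ?i + j) = a m * x + b m"
      using same_cluster_cross[of "3 * ?i + j" m x] j(2) by simp
    moreover have "3 * ?i + j < m" using j(1) mult_div_mod_eq[of 3 m] by linarith
    ultimately show "x \<in> crossings a b m" unfolding crossings_def by blast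
  qed
  have disj: "cr ` {..<3 * ?i} \<inter> vertices (m mod 3) = {}"
  proof (rule ccontr)
    assume "cr ` {..<3 * ?i} \<inter> vertices (m mod 3) \<noteq> {}"
    then obtain k where k: "k < 3 * ?i" "cr k \<in> vertices (m mod 3)" by auto
    then obtain j where j: "j < m mod 3" "\<alpha> j * cr k + \<beta> j = \<alpha> (m mod 3) * cr k + \<beta> (m mod 3)"
      by (auto simp: vertices_def)
    have "m mod 3 < 3" by simp
    then show False using vertex[of j "m mod 3" "cr k"] j rng[OF k(1)] by auto
  qed
  have fin: "finite (crossings a b m)" unfolding eq by simp
  have "3 * ?i + card (vertices (m mod 3)) = card (cr ` {..<3 * ?i}) + card (vertices (m mod 3))"
    using card_image[OF inj] by simp
  also have "\<dots> = card (cr ` {..<3 * ?i} \<union> vertices (m mod 3))"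
    using disj finite_subset[OF V fin] by (intro card_Un_disjoint[symmetric]) auto
  also have "\<dots> \<le> card (crossings a b m)"
    using V lt fin unfolding eq by (intro card_mono) auto
  finally show ?thesis .
qed

lemma Union_shape: "(\<Union>i<n. shape i) = (\<Union>k<3 * n. on_line (a k) (b k) ` I (k mod 3))"
proof -
  have "(\<Union>k<3 * n. on_line (a k) (b k) ` I (k mod 3)) \<subseteq> (\<Union>i<n. shape i)"
  proof (intro UN_least)
    fix k assume "k \<in> {..<3 * n}"
    then have "k div 3 < n" "k mod 3 < 3" by auto
    then show "on_line (a k) (b k) ` I (k mod 3) \<subseteq> (\<Union>i<n. shape i)"
      unfolding shape_def a_def b_def by blast
  qed
  moreover
  have "on_line (2 * real i + \<alpha> j) (- (real i)\<^sup>2 + \<beta> j) ` I j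
      \<subseteq> (\<Union>k<3 * n. on_line (a k) (b k) ` I (k mod 3))" if "i < n" "j < 3" for i j
  proof -
    let ?k = "3 * i + j"
    have k: "?k div 3 = i" "?k mod 3 = j" "?k \<in> {..<3 * n}" using that by auto
    have "on_line (a ?k) (b ?k) ` I (?k mod 3) \<subseteq> (\<Union>k<3 * n. on_line (a k) (b k) ` I (k mod 3))"
      using k(3) by (rule UN_upper)
    then show ?thesis unfolding a_def b_def k .
  qed
  then have "shape i \<subseteq> (\<Union>k<3 * n. on_line (a k) (b k) ` I (k mod 3))" if "i < n" for i
    unfolding shape_def using that by (intro UN_least) auto
  then have "(\<Union>i<n. shape i) \<subseteq> (\<Union>k<3 * n. on_line (a k) (b k) ` I (k mod 3))"
    by (intro UN_least) auto
  ultimately show ?thesis by (rule equalityI[rotated])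
qed

text \<open>Cluster \<open>i\<close> adds \<open>9 * i\<close>, its own vertices and 3 to the
  regions of the arrangement and loses one region per missing end. By \<open>e\<close> at least
  \<open>9 * i + 2\<close> remain, which is exactly the charge in the upper bound.\<close>

lemma regions_lower_bound:
  assumes fin: "finite (regions n shape)"
    and e: "(\<Sum>j<3. ends (I j)) \<le> (\<Sum>j<3. card (vertices j)) + 1"
  shows "9 * n ^ 2 + 2 \<le> 2 * card (regions n shape) + 5 * n"
proof -
  let ?S = "\<Union>k<3 * n. on_line (a k) (b k) ` I (k mod 3)"
  let ?L = "\<Union>k<3 * n. range (on_line (a k) (b k))"
  have reg: "regions n shape = components (- ?S)"
    unfolding regions_def Union_shape by (simp add: Compl_eq_Diff_UNIV)
  have "cuts (\<Sum>k<3 * n. ends (I (k mod 3))) ?S ?L"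
  proof (rule cuts_extend_lines)
    fix k assume "k < 3 * n"
    have "(1 / 4 :: real) \<in> {1 / 4..real n + 1}" by simp
    then show "closed (I (k mod 3)) \<and> convex (I (k mod 3)) \<and> I (k mod 3) \<noteq> {}"
      using interval[of "k mod 3"] by auto
  qed (rule crossing_in_interval)
  then have L: "finite (components (- ?L))"
    "card (components (- ?L)) \<le> card (regions n shape) + (\<Sum>k<3 * n. ends (I (k mod 3)))"
    using fin unfolding cuts_def reg by auto
  have "1 + (\<Sum>k<3 * n. 3 * (k div 3) + card (vertices (k mod 3)) + 1)
      \<le> 1 + (\<Sum>k<3 * n. card (crossings a b k) + 1)"
    using card_crossings by (intro add_left_mono sum_mono) auto
  also have "\<dots> \<le> card (sign_sets a b (3 * n))"
    using distinct_slopes by (intro card_sign_sets) auto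
  also have "\<dots> \<le> card (components (- ?L))"
    using L(1) by (rule card_sign_sets_le_components)
  finally have main: "1 + (\<Sum>k<3 * n. 3 * (k div 3) + card (vertices (k mod 3)) + 1)
      \<le> card (regions n shape) + (\<Sum>k<3 * n. ends (I (k mod 3)))"
    using L(2) by linarith
  have 1: "(\<Sum>k<3 * n. ends (I (k mod 3))) = n * (\<Sum>j<3. ends (I j))"
    unfolding sum_lessThan_3_mult by (simp add: sum_lessThan_3)
  have 2: "(\<Sum>k<3 * n. 3 * (k div 3) + card (vertices (k mod 3)) + 1)
      = (\<Sum>i<n. 9 * i) + n * ((\<Sum>j<3. card (vertices j)) + 3)"
  proof -
    have "(\<Sum>j<3. 3 * ((3 * i + j) div 3) + card (vertices ((3 * i + j) mod 3)) + 1)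
        = 9 * i + ((\<Sum>j<3. card (vertices j)) + 3)" for i
      by (simp add: sum_lessThan_3)
    then show ?thesis unfolding sum_lessThan_3_mult by (simp add: sum.distrib)
  qed
  have 3: "2 * (\<Sum>i<n. 9 * i) + 9 * n = 9 * n ^ 2" for n :: nat
    by (induction n) (auto simp: power2_eq_square algebra_simps)
  have "n * (\<Sum>j<3. ends (I j)) \<le> n * ((\<Sum>j<3. card (vertices j)) + 1)"
    using e by (rule mult_left_mono) simp
  then show ?thesis using main 3[of n] unfolding 1 2 by (simp add: algebra_simps)
qed

lemma is_max_regions_template:
  assumes F: "\<And>S. S \<in> F \<Longrightarrow> cuts_like_three_pieces S"
    and shape: "\<And>i. i < n \<Longrightarrow> shape i \<in> F"
    and e: "(\<Sum>j<3. ends (I j)) \<le> (\<Sum>j<3. card (vertices j)) + 1"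
  shows "is_max_regions F n ((9 * real n ^ 2 - 5 * real n + 2) / 2)"
  unfolding is_max_regions_def
proof (intro conjI allI impI exI)
  have *: "real c \<le> (9 * real n ^ 2 - 5 * real n + 2) / 2" if "2 * c + 5 * n \<le> 9 * n ^ 2 + 2" for c
  proof -
    have "real (2 * c + 5 * n) \<le> real (9 * n ^ 2 + 2)" using that by (rule of_nat_mono)
    then show ?thesis by simp
  qed
  show "shape i \<in> F" if "i < n" for i using shape that .
  show fin: "finite (regions n shape)" using F shape by (intro regions_upper_bound(1)) auto
  have "2 * card (regions n shape) + 5 * n \<le> 9 * n ^ 2 + 2"
    using F shape by (intro regions_upper_bound(2)) auto
  then have "2 * card (regions n shape) + 5 * n = 9 * n ^ 2 + 2"
    using regions_lower_bound[OF fin e] by simp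
  then have "real (2 * card (regions n shape) + 5 * n) = real (9 * n ^ 2 + 2)" by simp
  then show "real (card (regions n shape)) = (9 * real n ^ 2 - 5 * real n + 2) / 2" by simp
  fix S assume S: "\<forall>i<n. S i \<in> F"
  then show "finite (regions n S)" using F by (intro regions_upper_bound(1)) auto
  show "real (card (regions n S)) \<le> (9 * real n ^ 2 - 5 * real n + 2) / 2"
    using S F by (intro * regions_upper_bound(2)) auto
qed

end

section \<open>Templates for the three families\<close>

lemma along_image_atMost: "along p v ` {..c} = ray (along p v c) (- v)"
proof -
  have "{..c} = (-) c ` {0..}" by simp
  then show ?thesis by (simp only: ray_eq_along image_image) (simp add: algebra_simps)
qed

lemma along_image_Icc:
  assumes "c \<le> d"
  shows "along p v ` {c..d} = closed_segment (along p v c) (along p v d)"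
proof -
  have "along p v ` closed_segment c d = (+) p ` ((\<lambda>t. t *\<^sub>R v) ` closed_segment c d)"
    by (simp add: image_image)
  also have "\<dots> = (+) p ` closed_segment (c *\<^sub>R v) (d *\<^sub>R v)"
    using closed_segment_linear_image[OF linear_scaleR_left[of v], of c d] by simp
  also have "\<dots> = closed_segment (along p v c) (along p v d)"
    by (simp only: closed_segment_translation)
  finally show ?thesis using assms by (simp add: closed_segment_eq_real_ivl)
qed

lemma less_3_cases: "(j::nat) < 3 \<Longrightarrow> j = 0 \<or> j = 1 \<or> j = 2"
  by auto

lemma UN_lessThan_3: "(\<Union>j<3::nat. A j) = A 0 \<union> A 1 \<union> A 2"
  by (auto simp: numeral_3_eq_3 numeral_2_eq_2 lessThan_Suc)

lemma ends_simps [simp]: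
  "ends {c..} = 1" "ends {..c} = 1" "c \<le> d \<Longrightarrow> ends {c..d} = 2"
proof -
  have "max c (M + 1) \<in> {c..}" "\<not> max c (M + 1) \<le> M" for M by auto
  then have "\<not> bdd_above {c..}" unfolding bdd_above_def by blast
  moreover have "min c (M - 1) \<in> {..c}" "\<not> M \<le> min c (M - 1)" for M by auto
  then have "\<not> bdd_below {..c}" unfolding bdd_below_def by blast
  ultimately show "ends {c..} = 1" "ends {..c} = 1" by (simp_all add: ends_def)
qed (simp add: ends_def)

lemma three_armed_Vs_max:
  "is_max_regions three_armed_Vs n ((9 * real n ^ 2 - 5 * real n + 2) / 2)"
proof -
  \<comment> \<open>The largest perturbation, \<open>2 * \<theta>\<close>, is exactly the permitted
    \<open>1 / (25 * (n + 1))\<close>.\<close>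
  define \<theta> where "\<theta> = 1 / (50 * (real n + 1))"
  have \<theta>: "\<theta> > 0" by (simp add: \<theta>_def)
  interpret cluster_template n "\<lambda>j. real j * \<theta>" "\<lambda>_. 0" "\<lambda>_. {0..}"
  proof
    fix j :: nat assume "j < 3"
    then have "real j * \<theta> \<le> 2 * \<theta>" using \<theta> by (intro mult_right_mono) auto
    then show "\<bar>real j * \<theta>\<bar> \<le> 1 / (25 * (real n + 1)) \<and> \<bar>0::real\<bar> \<le> 1 / (25 * (real n + 1))"
      using \<theta> by (simp add: \<theta>_def field_simps)
  qed (use \<theta> in auto)
  have "vertices 0 = {}" "vertices 1 = {0}" "vertices 2 = {0}"
    using \<theta> by (auto simp: vertices_def numeral_2_eq_2 less_Suc_eq)
  then show ?thesis
  proof (intro is_max_regions_template three_armed_V_cuts)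
    fix i
    show "shape i \<in> three_armed_Vs"
      unfolding shape_def UN_lessThan_3 ray_eq_along[symmetric] three_armed_Vs_def
      using slope_vector_nonzero by blast
  qed (simp_all add: sum_lessThan_3)
qed

text \<open>
  The three lines bound a flat triangle whose vertices have the abscissae \<open>0\<close>, \<open>1/4\<close> and \<open>n + 1\<close>.
  A self-crossing 3-chain and a long-legged A can both be drawn on them.
\<close>

definition tri_slope :: "nat \<Rightarrow> nat \<Rightarrow> real" where
  "tri_slope n = (\<lambda>_. 0)(1 := (4 * real n + 3) / (100 * (real n + 1)\<^sup>2), 2 := - 1 / (100 * (real n + 1)\<^sup>2))"

definition tri_icept :: "nat \<Rightarrow> nat \<Rightarrow> real" where
  "tri_icept n = (\<lambda>_. 0)(2 := (real n + 1) / (100 * (real n + 1)\<^sup>2))"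

lemma tri_simps [simp]:
  "tri_slope n 0 = 0" "tri_slope n (Suc 0) = (4 * real n + 3) / (100 * (real n + 1)\<^sup>2)"
  "tri_slope n 2 = - 1 / (100 * (real n + 1)\<^sup>2)"
  "tri_icept n 0 = 0" "tri_icept n (Suc 0) = 0" "tri_icept n 2 = (real n + 1) / (100 * (real n + 1)\<^sup>2)"
  by (auto simp: tri_slope_def tri_icept_def)

lemma tri_cross:
  "tri_slope n 0 * x + tri_icept n 0 = tri_slope n 1 * x + tri_icept n 1 \<longleftrightarrow> x = 0"
  "tri_slope n 0 * x + tri_icept n 0 = tri_slope n 2 * x + tri_icept n 2 \<longleftrightarrow> x = real n + 1"
  "tri_slope n 1 * x + tri_icept n 1 = tri_slope n 2 * x + tri_icept n 2 \<longleftrightarrow> x = 1 / 4"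
proof -
  define t where "t = 1 / (100 * (real n + 1)\<^sup>2)"
  have t: "t > 0" by (simp add: t_def)
  have eqs: "tri_slope n 1 = (4 * real n + 3) * t" "tri_slope n 2 = - t" "tri_icept n 2 = (real n + 1) * t"
    by (simp_all add: t_def)
  note tri_simps [simp del]
  have z: "tri_slope n 0 = 0" "tri_icept n 0 = 0" "tri_icept n 1 = 0" by (simp_all add: tri_simps)
  show "tri_slope n 0 * x + tri_icept n 0 = tri_slope n 1 * x + tri_icept n 1 \<longleftrightarrow> x = 0"
    using t by (simp add: eqs z del: One_nat_def)
  have "tri_slope n 2 * x + tri_icept n 2 = t * (real n + 1 - x)"
    by (simp add: eqs z algebra_simps del: One_nat_def)
  then show "tri_slope n 0 * x + tri_icept n 0 = tri_slope n 2 * x + tri_icept n 2 \<longleftrightarrow> x = real n + 1"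
    using t by (auto simp: z)
  have "(tri_slope n 2 * x + tri_icept n 2) - (tri_slope n 1 * x + tri_icept n 1) = t * (real n + 1) * (1 - 4 * x)"
    by (simp add: eqs z algebra_simps del: One_nat_def)
  moreover have "t * (real n + 1) \<noteq> 0" using t by simp
  then have "t * (real n + 1) * (1 - 4 * x) = 0 \<longleftrightarrow> x = 1 / 4" by auto
  ultimately show "tri_slope n 1 * x + tri_icept n 1 = tri_slope n 2 * x + tri_icept n 2 \<longleftrightarrow> x = 1 / 4"
    by (metis eq_iff_diff_eq_0)
qed

lemma tri_template:
  fixes I :: "nat \<Rightarrow> real set"
  assumes "\<And>j. j < 3 \<Longrightarrow> closed (I j) \<and> convex (I j) \<and> {1 / 4..real n + 1} \<subseteq> I j"
    and "0 \<in> I 0" "0 \<in> I 1"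
  shows "cluster_template n (tri_slope n) (tri_icept n) I"
proof
  have mem: "1 / 4 \<in> I j" "real n + 1 \<in> I j" if "j < 3" for j
    using assms(1)[OF that] by (auto simp: subset_iff)
  fix j :: nat assume j: "j < 3"
  have bound: "\<bar>c / (100 * (real n + 1)\<^sup>2)\<bar> \<le> 1 / (25 * (real n + 1))" if "\<bar>c\<bar> \<le> 4 * (real n + 1)" for c
  proof -
    have "\<bar>c / (100 * (real n + 1)\<^sup>2)\<bar> = \<bar>c\<bar> / (100 * (real n + 1)\<^sup>2)" by (simp add: abs_divide)
    also have "\<dots> \<le> 4 * (real n + 1) / (100 * (real n + 1)\<^sup>2)"
      using that by (intro divide_right_mono) auto
    also have "\<dots> = 1 / (25 * (real n + 1))" by (simp add: power2_eq_square divide_simps) (simp add: algebra_simps)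
    finally show ?thesis .
  qed
  show "\<bar>tri_slope n j\<bar> \<le> 1 / (25 * (real n + 1)) \<and> \<bar>tri_icept n j\<bar> \<le> 1 / (25 * (real n + 1))"
    using less_3_cases[OF j] bound[of "4 * real n + 3"] bound[of "- 1"] bound[of "real n + 1"] by auto
  fix j' :: nat assume j': "j' < 3" and ne: "j \<noteq> j'"
  show "tri_slope n j \<noteq> tri_slope n j'"
    using less_3_cases[OF j] less_3_cases[OF j'] ne
    by (auto simp: divide_eq_eq eq_divide_eq add_nonneg_eq_0_iff)
  fix x assume "tri_slope n j * x + tri_icept n j = tri_slope n j' * x + tri_icept n j'"
  then have "(x = 0 \<and> j \<noteq> 2) \<or> x = real n + 1 \<or> x = 1 / 4"
    using less_3_cases[OF j] less_3_cases[OF j'] ne tri_cross[of n x] by metis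
  moreover have "0 \<in> I j" if "j \<noteq> 2" using less_3_cases[OF j] that assms by auto
  ultimately have "x \<in> I j" "x \<in> {0, real n + 1, 1 / 4}" using mem[OF j] by blast+
  then show "x \<in> I j \<and> (x \<le> 1 / 4 \<or> x \<ge> real n + 1)" by auto
qed (use assms in auto)

lemma tri_max:
  assumes I: "\<And>J. J \<in> {I\<^sub>0, I\<^sub>1, I\<^sub>2} \<Longrightarrow> closed J \<and> convex J \<and> {1 / 4..real n + 1} \<subseteq> J"
      "0 \<in> I\<^sub>0" "0 \<in> I\<^sub>1"
    and ends: "ends I\<^sub>0 + ends I\<^sub>1 + ends I\<^sub>2 = 4"
    and F: "\<And>S. S \<in> F \<Longrightarrow> cuts_like_three_pieces S"
    and shape: "\<And>s c. on_line s c ` I\<^sub>0 \<union> on_line (s + tri_slope n 1) c ` I\<^sub>1 \<union>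
                   on_line (s + tri_slope n 2) (c + tri_icept n 2) ` I\<^sub>2 \<in> F"
  shows "is_max_regions F n ((9 * real n ^ 2 - 5 * real n + 2) / 2)"
proof -
  define I :: "nat \<Rightarrow> real set" where "I = (\<lambda>_. I\<^sub>0)(1 := I\<^sub>1, 2 := I\<^sub>2)"
  have I_simps: "I 0 = I\<^sub>0" "I 1 = I\<^sub>1" "I 2 = I\<^sub>2" by (simp_all add: I_def)
  interpret cluster_template n "tri_slope n" "tri_icept n" I
  proof (rule tri_template)
    fix j :: nat assume "j < 3"
    then have "I j \<in> {I\<^sub>0, I\<^sub>1, I\<^sub>2}" by (simp add: I_def)
    then show "closed (I j) \<and> convex (I j) \<and> {1 / 4..real n + 1} \<subseteq> I j" by (rule I(1))
  qed (use I(2,3) I_simps in auto)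
  have "vertices 0 = {}" "vertices 1 = {0}" "vertices 2 = {real n + 1, 1 / 4}"
  proof -
    show "vertices 0 = {}" by (simp add: vertices_def)
    show "vertices 1 = {0}" unfolding vertices_def using tri_cross(1)[of n] by auto
    have two: "(\<exists>j<2. P j) \<longleftrightarrow> P 0 \<or> P 1" for P :: "nat \<Rightarrow> bool"
      by (auto simp: numeral_2_eq_2 less_Suc_eq)
    show "vertices 2 = {real n + 1, 1 / 4}"
      unfolding vertices_def two tri_cross(2,3) by blast
  qed
  then show ?thesis
    using F
  proof (intro is_max_regions_template)
    fix i
    show "shape i \<in> F"
      using shape[where s = "2 * real i" and c = "- (real i)\<^sup>2"] unfolding shape_def UN_lessThan_3 I_simps by simp
  qed (use ends in \<open>simp_all add: sum_lessThan_3 I_simps[simplified]\<close>)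
qed

lemma three_chainsI:
  "u \<noteq> 0 \<Longrightarrow> v \<noteq> 0 \<Longrightarrow> p \<noteq> q \<Longrightarrow> ray p u \<union> closed_segment p q \<union> ray q v \<in> three_chains"
  unfolding three_chains_def by blast

lemma long_legged_AsI:
  "u \<noteq> 0 \<Longrightarrow> v \<noteq> 0 \<Longrightarrow> a \<in> ray p u \<Longrightarrow> b \<in> ray p v \<Longrightarrow> a \<noteq> b \<Longrightarrow>
     ray p u \<union> ray p v \<union> closed_segment a b \<in> long_legged_As"
  unfolding long_legged_As_def by blast

lemma three_chains_max:
  "is_max_regions three_chains n ((9 * real n ^ 2 - 5 * real n + 2) / 2)"
proof (rule tri_max[of "{0..real n + 1}" "{0..}" "{..real n + 1}"])
  fix s c :: real
  define v :: "nat \<Rightarrow> real^2" where "v j = vector [1, s + tri_slope n j]" for j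
  define p :: "real^2" where "p = vector [0, c]"
  define q where "q = on_line s c (real n + 1)"
  have q: "q = on_line (s + tri_slope n 2) (c + tri_icept n 2) (real n + 1)"
    unfolding q_def on_line_eq_iff using tri_cross(2)[of n "real n + 1"] by (simp add: algebra_simps)
  have "p \<noteq> q"
  proof
    assume "p = q"
    then have "p $ 1 = q $ 1" by simp
    then show False unfolding p_def q_def on_line_nth by simp
  qed
  have "on_line s c ` {0..real n + 1} = closed_segment p q"
    unfolding q_def p_def by (simp add: along_image_Icc)
  moreover have "on_line (s + tri_slope n 1) c ` {0..} = ray p (v 1)"
    by (simp add: ray_eq_along p_def v_def)
  moreover have "on_line (s + tri_slope n 2) (c + tri_icept n 2) ` {..real n + 1} = ray q (- v 2)"
    unfolding along_image_atMost q v_def ..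
  ultimately have eq: "on_line s c ` {0..real n + 1} \<union> on_line (s + tri_slope n 1) c ` {0..} \<union>
      on_line (s + tri_slope n 2) (c + tri_icept n 2) ` {..real n + 1}
    = ray p (v 1) \<union> closed_segment p q \<union> ray q (- v 2)"
    by (simp only: Un_commute)
  have "v 1 \<noteq> 0" "- v 2 \<noteq> 0" by (simp_all add: v_def)
  then show "on_line s c ` {0..real n + 1} \<union> on_line (s + tri_slope n 1) c ` {0..} \<union>
      on_line (s + tri_slope n 2) (c + tri_icept n 2) ` {..real n + 1} \<in> three_chains"
    unfolding eq using \<open>p \<noteq> q\<close> by (rule three_chainsI)
qed (auto intro: three_chain_cuts)

lemma long_legged_As_max:
  "is_max_regions long_legged_As n ((9 * real n ^ 2 - 5 * real n + 2) / 2)"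
proof (rule tri_max[of "{0..}" "{0..}" "{1 / 4..real n + 1}"])
  fix s c :: real
  define v :: "nat \<Rightarrow> real^2" where "v j = vector [1, s + tri_slope n j]" for j
  define p :: "real^2" where "p = vector [0, c]"
  let ?L = "on_line (s + tri_slope n 2) (c + tri_icept n 2)"
  have x: "?L (1 / 4) = on_line (s + tri_slope n 1) c (1 / 4)"
    unfolding on_line_eq_iff using tri_cross(3)[of n "1 / 4"] by (simp add: algebra_simps)
  have y: "?L (real n + 1) = on_line s c (real n + 1)"
    unfolding on_line_eq_iff using tri_cross(2)[of n "real n + 1"] by (simp add: algebra_simps)
  have r: "on_line (s + tri_slope n 1) c ` {0..} = ray p (v 1)" "on_line s c ` {0..} = ray p (v 0)"
    by (simp_all add: ray_eq_along p_def v_def)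
  have xy: "?L (1 / 4) \<in> ray p (v 1)" "?L (real n + 1) \<in> ray p (v 0)"
    unfolding x y r[symmetric] by (intro imageI; simp)+
  have ne: "?L (1 / 4) \<noteq> ?L (real n + 1)" unfolding on_line_eq_iff by simp
  have v: "v 1 \<noteq> 0" "v 0 \<noteq> 0" by (simp_all add: v_def)
  have eq: "on_line s c ` {0..} \<union> on_line (s + tri_slope n 1) c ` {0..} \<union> ?L ` {1 / 4..real n + 1}
    = ray p (v 1) \<union> ray p (v 0) \<union> closed_segment (?L (1 / 4)) (?L (real n + 1))"
  proof -
    have "?L ` {1 / 4..real n + 1} = closed_segment (?L (1 / 4)) (?L (real n + 1))"
      by (intro along_image_Icc) simp
    then show ?thesis unfolding r by blast
  qed
  show "on_line s c ` {0..} \<union> on_line (s + tri_slope n 1) c ` {0..} \<union> ?L ` {1 / 4..real n + 1} \<in> long_legged_As"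
    unfolding eq using v xy ne by (rule long_legged_AsI)
qed (auto intro: long_legged_A_cuts)

theorem theorem1:
  fixes n :: nat
  shows "is_max_regions three_armed_Vs n ((9 * real n ^ 2 - 5 * real n + 2) / 2)
       \<and> is_max_regions three_chains n ((9 * real n ^ 2 - 5 * real n + 2) / 2)
       \<and> is_max_regions long_legged_As n ((9 * real n ^ 2 - 5 * real n + 2) / 2)"
  using three_armed_Vs_max three_chains_max long_legged_As_max by blast

end
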